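(* Let $G$ be a group and let $R$ be a $G$-graded ring which is graded left injective. Then $\mathcal{Z}^{\rm gr}({}_RR)=J^{\rm gr}(R)$ and $R/J^{\rm gr}(R)$ is graded von Neumann regular.
   Context: Rings are associative with identity; a $G$-graded ring is $R=\bigoplus_{g\in G}R_g$ with $R_gR_h\subset R_{gh}$. $R-gr$ is the category of graded left $R$-modules $M=\bigoplus_gM_g$ ($R_gM_h\subset M_{gh}$) with degree-preserving $R$-linear maps. $R$ is graded left injective if $R$ is an injective object of $R-gr$. $J^{\rm gr}(R)$ (graded Jacobson radical) is the intersection of all maximal graded left ideals of $R$; it is a graded two-sided ideal. For $x\in R$, $\mathrm{ann}_\ell(x)=\{r\in R: rx=0\}$. For $g\in G$ put $\mathcal{Z}^{\rm gr}({}_RR)_g=\{x\in R_g:\mathrm{ann}_\ell(x)\text{ is essential in }{}_RR\}$ and $\mathcal{Z}^{\rm gr}({}_RR)=\sum_{g\in G}\mathcal{Z}^{\rm gr}({}_RR)_g$, a graded two-sided ideal. A graded ring $R$ is graded von Neumann regular if for every homogeneous $a\in R$ there is $b\in R$ with $a=aba$. *)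

theory Defs
  imports "HOL-Algebra.QuotRing" "HOL-Algebra.Module" "HOL-Library.Equipollence"
begin

section \<open>Left modules and left ideals\<close>

text \<open>
  The library locale \<open>module\<close> presupposes a commutative ring of scalars, and the library has
  only two-sided ideals.  As in the library, modules are represented by the record type
  \<open>module\<close>, whose fields for multiplication and unit carry no meaning.
\<close>

locale left_module = R?: ring R + M?: abelian_group M
  for R :: "('r, 's) ring_scheme" (structure) and M :: "('r, 'm) module" (structure) +
  assumes smult_closed:
      "\<lbrakk>a \<in> carrier R; x \<in> carrier M\<rbrakk> \<Longrightarrow> a \<odot>\<^bsub>M\<^esub> x \<in> carrier M"
    and smult_l_distr:
      "\<lbrakk>a \<in> carrier R; b \<in> carrier R; x \<in> carrier M\<rbrakk> \<Longrightarrow>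
        (a \<oplus>\<^bsub>R\<^esub> b) \<odot>\<^bsub>M\<^esub> x = a \<odot>\<^bsub>M\<^esub> x \<oplus>\<^bsub>M\<^esub> b \<odot>\<^bsub>M\<^esub> x"
    and smult_r_distr:
      "\<lbrakk>a \<in> carrier R; x \<in> carrier M; y \<in> carrier M\<rbrakk> \<Longrightarrow>
        a \<odot>\<^bsub>M\<^esub> (x \<oplus>\<^bsub>M\<^esub> y) = a \<odot>\<^bsub>M\<^esub> x \<oplus>\<^bsub>M\<^esub> a \<odot>\<^bsub>M\<^esub> y"
    and smult_assoc:
      "\<lbrakk>a \<in> carrier R; b \<in> carrier R; x \<in> carrier M\<rbrakk> \<Longrightarrow>
        (a \<otimes>\<^bsub>R\<^esub> b) \<odot>\<^bsub>M\<^esub> x = a \<odot>\<^bsub>M\<^esub> (b \<odot>\<^bsub>M\<^esub> x)"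
    and smult_one:
      "x \<in> carrier M \<Longrightarrow> \<one>\<^bsub>R\<^esub> \<odot>\<^bsub>M\<^esub> x = x"

definition regular_module :: "('r, 's) ring_scheme \<Rightarrow> ('r, 'r) module" where
  "regular_module R =
    \<lparr>carrier = carrier R, mult = mult R, one = one R, zero = zero R, add = add R,
     smult = mult R\<rparr>"

locale left_ideal = additive_subgroup I R + ring R
  for I and R (structure) +
  assumes l_mult_closed: "\<lbrakk>a \<in> I; x \<in> carrier R\<rbrakk> \<Longrightarrow> x \<otimes> a \<in> I"

definition left_annihilator :: "('r, 's) ring_scheme \<Rightarrow> 'r \<Rightarrow> 'r set" where
  "left_annihilator R x = {r \<in> carrier R. r \<otimes>\<^bsub>R\<^esub> x = \<zero>\<^bsub>R\<^esub>}"

definition essential_left_ideal :: "('r, 's) ring_scheme \<Rightarrow> 'r set \<Rightarrow> bool" where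
  "essential_left_ideal R L \<longleftrightarrow> left_ideal L R \<and>
    (\<forall>K. left_ideal K R \<and> K \<noteq> {\<zero>\<^bsub>R\<^esub>} \<longrightarrow> L \<inter> K \<noteq> {\<zero>\<^bsub>R\<^esub>})"


section \<open>Gradings\<close>

text \<open>
  \<open>is_decomposition M I N x f\<close>: the family \<open>f\<close>, of finite support and with
  \<open>f i \<in> N i\<close> for \<open>i \<in> I\<close>, sums to \<open>x\<close>.
  Families are extensional (undefined outside \<open>I\<close>), so that uniqueness can be stated as
  uniqueness of a function.
\<close>

definition is_decomposition ::
  "('a, 's) ring_scheme \<Rightarrow> 'g set \<Rightarrow> ('g \<Rightarrow> 'a set) \<Rightarrow> 'a \<Rightarrow> ('g \<Rightarrow> 'a) \<Rightarrow> bool" where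
  "is_decomposition M I N x f \<longleftrightarrow>
    f \<in> (\<Pi>\<^sub>E i\<in>I. N i) \<and>
    finite {i \<in> I. f i \<noteq> \<zero>\<^bsub>M\<^esub>} \<and>
    x = (\<Oplus>\<^bsub>M\<^esub>i\<in>{i \<in> I. f i \<noteq> \<zero>\<^bsub>M\<^esub>}. f i)"

definition internal_direct_sum ::
  "('a, 's) ring_scheme \<Rightarrow> 'g set \<Rightarrow> ('g \<Rightarrow> 'a set) \<Rightarrow> bool" where
  "internal_direct_sum M I N \<longleftrightarrow>
    (\<forall>i\<in>I. additive_subgroup (N i) M) \<and>
    (\<forall>x\<in>carrier M. \<exists>!f. is_decomposition M I N x f)"

locale graded_ring = G?: group G + R?: ring R
  for G :: "('g, 't) monoid_scheme" (structure)
    and R :: "('r, 's) ring_scheme" (structure)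
    and A :: "'g \<Rightarrow> 'r set" +
  assumes direct_sum: "internal_direct_sum R (carrier G) A"
    and graded_mult:
      "\<lbrakk>g \<in> carrier G; h \<in> carrier G; x \<in> A g; y \<in> A h\<rbrakk> \<Longrightarrow>
        x \<otimes>\<^bsub>R\<^esub> y \<in> A (g \<otimes>\<^bsub>G\<^esub> h)"

locale graded_left_module = graded_ring G R A + left_module R M
  for G :: "('g, 't) monoid_scheme" (structure)
    and R :: "('r, 's) ring_scheme" (structure)
    and A :: "'g \<Rightarrow> 'r set"
    and M :: "('r, 'm) module" (structure)
    and B :: "'g \<Rightarrow> 'm set" +
  assumes module_direct_sum: "internal_direct_sum M (carrier G) B"
    and graded_smult:
      "\<lbrakk>g \<in> carrier G; h \<in> carrier G; a \<in> A g; x \<in> B h\<rbrakk> \<Longrightarrow>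
        a \<odot>\<^bsub>M\<^esub> x \<in> B (g \<otimes>\<^bsub>G\<^esub> h)"

definition gr_hom ::
  "('g, 't) monoid_scheme \<Rightarrow> ('r, 's) ring_scheme \<Rightarrow>
   ('r, 'm) module \<Rightarrow> ('g \<Rightarrow> 'm set) \<Rightarrow> ('r, 'n) module \<Rightarrow> ('g \<Rightarrow> 'n set) \<Rightarrow> ('m \<Rightarrow> 'n) set" where
  "gr_hom G R M B N C =
    {f \<in> carrier M \<rightarrow> carrier N.
      (\<forall>x\<in>carrier M. \<forall>y\<in>carrier M. f (x \<oplus>\<^bsub>M\<^esub> y) = f x \<oplus>\<^bsub>N\<^esub> f y) \<and>
      (\<forall>a\<in>carrier R. \<forall>x\<in>carrier M. f (a \<odot>\<^bsub>M\<^esub> x) = a \<odot>\<^bsub>N\<^esub> f x) \<and>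
      (\<forall>g\<in>carrier G. f ` B g \<subseteq> C g)}"


section \<open>Graded injectivity\<close>

text \<open>
  Injective objects of the category of graded left modules.  HOL cannot quantify over types
  inside a formula, so the universe in which the test modules \<open>M\<close>, \<open>N\<close> live is the type
  parameter \<open>'m\<close>: their carriers are arbitrary subsets of \<open>'m\<close>.  By the graded Baer criterion,
  over a ring \<open>R\<close> the notion does not depend on \<open>'m\<close> as soon as \<open>'m\<close> has room for a copy of
  the carrier of \<open>R\<close>; for smaller \<open>'m\<close> it is too weak (it is void when \<open>'m\<close> has one element).
\<close>

definition gr_injective_module ::
  "'m itself \<Rightarrow> ('g, 't) monoid_scheme \<Rightarrow> ('r, 's) ring_scheme \<Rightarrow> ('g \<Rightarrow> 'r set) \<Rightarrow>
   ('r, 'e) module \<Rightarrow> ('g \<Rightarrow> 'e set) \<Rightarrow> bool" where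
  "gr_injective_module (_ :: 'm itself) G R A E D \<longleftrightarrow>
    graded_left_module G R A E D \<and>
    (\<forall>(M :: ('r, 'm) module) B (N :: ('r, 'm) module) C i f.
      graded_left_module G R A M B \<and> graded_left_module G R A N C \<and>
      i \<in> gr_hom G R M B N C \<and> inj_on i (carrier M) \<and>
      f \<in> gr_hom G R M B E D \<longrightarrow>
      (\<exists>h \<in> gr_hom G R N C E D. \<forall>x\<in>carrier M. h (i x) = f x))"

definition gr_left_injective ::
  "'m itself \<Rightarrow> ('g, 't) monoid_scheme \<Rightarrow> ('r, 's) ring_scheme \<Rightarrow> ('g \<Rightarrow> 'r set) \<Rightarrow> bool" where
  "gr_left_injective U G R A \<longleftrightarrow> gr_injective_module U G R A (regular_module R) A"


section \<open>Graded Jacobson radical and graded singular ideal\<close>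

definition graded_left_ideal ::
  "('g, 't) monoid_scheme \<Rightarrow> ('r, 's) ring_scheme \<Rightarrow> ('g \<Rightarrow> 'r set) \<Rightarrow> 'r set \<Rightarrow> bool" where
  "graded_left_ideal G R A L \<longleftrightarrow> left_ideal L R \<and>
    (\<forall>x\<in>L. \<exists>f. is_decomposition R (carrier G) (\<lambda>g. L \<inter> A g) x f)"

definition maximal_graded_left_ideal ::
  "('g, 't) monoid_scheme \<Rightarrow> ('r, 's) ring_scheme \<Rightarrow> ('g \<Rightarrow> 'r set) \<Rightarrow> 'r set \<Rightarrow> bool" where
  "maximal_graded_left_ideal G R A L \<longleftrightarrow>
    graded_left_ideal G R A L \<and> L \<noteq> carrier R \<and>
    (\<forall>K. graded_left_ideal G R A K \<and> L \<subseteq> K \<longrightarrow> K = L \<or> K = carrier R)"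

text \<open>Intersecting with the carrier only matters for the zero ring (empty intersection).\<close>

definition gr_jacobson_radical ::
  "('g, 't) monoid_scheme \<Rightarrow> ('r, 's) ring_scheme \<Rightarrow> ('g \<Rightarrow> 'r set) \<Rightarrow> 'r set" where
  "gr_jacobson_radical G R A = carrier R \<inter> \<Inter>{L. maximal_graded_left_ideal G R A L}"

definition gr_singular_component ::
  "('r, 's) ring_scheme \<Rightarrow> ('g \<Rightarrow> 'r set) \<Rightarrow> 'g \<Rightarrow> 'r set" where
  "gr_singular_component R A g =
    {x \<in> A g. essential_left_ideal R (left_annihilator R x)}"

definition gr_left_singular_ideal ::
  "('g, 't) monoid_scheme \<Rightarrow> ('r, 's) ring_scheme \<Rightarrow> ('g \<Rightarrow> 'r set) \<Rightarrow> 'r set" where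
  "gr_left_singular_ideal G R A =
    {\<Oplus>\<^bsub>R\<^esub>g\<in>F. z g | F z. finite F \<and> F \<subseteq> carrier G \<and>
      z \<in> (\<Pi> g\<in>F. gr_singular_component R A g)}"


section \<open>Quotient grading and graded von Neumann regularity\<close>

definition quotient_grading ::
  "('r, 's) ring_scheme \<Rightarrow> 'r set \<Rightarrow> ('g \<Rightarrow> 'r set) \<Rightarrow> 'g \<Rightarrow> 'r set set" where
  "quotient_grading R I A g = (\<lambda>x. I +>\<^bsub>R\<^esub> x) ` A g"

locale gr_von_neumann_regular = graded_ring G R A
  for G :: "('g, 't) monoid_scheme" (structure)
    and R :: "('r, 's) ring_scheme" (structure)
    and A :: "'g \<Rightarrow> 'r set" +
  assumes regular:
    "\<lbrakk>g \<in> carrier G; a \<in> A g\<rbrakk> \<Longrightarrow> \<exists>b\<in>carrier R. a = a \<otimes>\<^bsub>R\<^esub> b \<otimes>\<^bsub>R\<^esub> a"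

end

theory Submission
  imports Defs
begin

text \<open>
  Self-injectivity enters once.  If right multiplication by a homogeneous element \<open>a\<close> of
  degree \<open>g\<close> is injective on a graded left ideal \<open>K\<close>, it embeds \<open>K\<close> into \<open>R\<close> with its grading
  shifted by \<open>g\<close>; extending the inclusion of \<open>K\<close> along this embedding gives a homogeneous \<open>b\<close>
  with \<open>k a b = k\<close> for all \<open>k\<close> in \<open>K\<close>.

  If the annihilator of \<open>x\<close> is essential, then \<open>1 - x r\<close> has zero left annihilator
  whenever it has degree one, so taking \<open>K = R\<close> it is right invertible, and
  then two-sided invertible; hence \<open>x\<close> lies in the radical.  Conversely, take for \<open>K\<close> a
  complement of the annihilator of \<open>a\<close>: then \<open>a - a b a\<close> is annihilated by \<open>K + ann a\<close>, which
  is essential, so \<open>R\<close> is regular modulo the singular ideal; and if \<open>a\<close> lies in the radical,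
  then \<open>1 - b a\<close> is a unit, so that \<open>a\<close> itself has essential annihilator.
\<close>

section \<open>Internal direct sums\<close>

text \<open>Two points shape the proof. Essentiality of an annihilator is tested against all left
  ideals, whereas Zorn's lemma yields a complement that is maximal only among graded ones.
  \<open>homog_multiple_in_graded_left_ideal\<close> bridges the gap: if every nonzero homogeneous
  element can be moved into \<open>D\<close> by a homogeneous scalar without becoming zero, then so
  can every nonzero element. The step from one-sided to two-sided inverses is a repetition of the
  one-sided argument. If \<open>(1 - x r) c = 1\<close>, then \<open>c = 1 + x r c\<close> is again
  of the form \<open>1 - x r'\<close>, with \<open>r'\<close> of the same degree as
  \<open>r\<close>; so \<open>c\<close> has a right inverse as well, and having inverses on both
  sides it is a unit. The mirrored device makes \<open>1 - b a\<close> a unit when \<open>a\<close>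
  lies in the radical. All these units have degree one, which suffices because membership of a
  homogeneous element in the radical is decided by elements of degree one.\<close>

lemma (in abelian_monoid) is_decompositionI:
  assumes "finite F" "F \<subseteq> I" "z \<in> Pi F N"
    and N: "\<And>i. i \<in> I \<Longrightarrow> \<zero> \<in> N i \<and> N i \<subseteq> carrier G"
    and x: "x = finsum G z F"
  shows "is_decomposition G I N x (\<lambda>i\<in>I. if i \<in> F then z i else \<zero>)"
proof -
  let ?f = "\<lambda>i\<in>I. if i \<in> F then z i else \<zero>"
  have eq: "{i \<in> I. ?f i \<noteq> \<zero>} = {i \<in> F. z i \<noteq> \<zero>}" using assms(2) by auto
  have "z i \<in> carrier G" if "i \<in> F" for i using that assms(2,3) N by blast
  then have zc: "z \<in> F \<rightarrow> carrier G" by blast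
  have "finsum G ?f {i \<in> F. z i \<noteq> \<zero>} = finsum G z F"
    by (rule add.finprod_mono_neutral_cong_left) (use assms(1,2) zc in auto)
  then show ?thesis
    unfolding is_decomposition_def eq using assms by auto
qed

lemma (in abelian_monoid) finsum_decomposition:
  assumes "is_decomposition G I N x f" "finite F" "{i \<in> I. f i \<noteq> \<zero>} \<subseteq> F" "F \<subseteq> I" "f \<in> F \<rightarrow> carrier G"
  shows "finsum G f F = x"
proof -
  have "finsum G f {i \<in> I. f i \<noteq> \<zero>} = finsum G f F"
    by (rule add.finprod_mono_neutral_cong_left) (use assms in auto)
  then show ?thesis using assms(1) unfolding is_decomposition_def by simp
qed

text \<open>Summing the difference of two decompositions over the union of their supports gives a
  zero sum, so uniqueness reduces to independence. This criterion, free of extensionality and exact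
  supports, is the one checked for shifted copies of left ideals and for quotient rings.\<close>

lemma (in abelian_group) internal_direct_sumI:
  assumes sub: "\<And>i. i \<in> I \<Longrightarrow> additive_subgroup (N i) G"
    and ex: "\<And>x. x \<in> carrier G \<Longrightarrow>
      \<exists>F z. finite F \<and> F \<subseteq> I \<and> z \<in> Pi F N \<and> x = finsum G z F"
    and indep: "\<And>F z i. \<lbrakk>finite F; F \<subseteq> I; z \<in> Pi F N; finsum G z F = \<zero>; i \<in> F\<rbrakk> \<Longrightarrow> z i = \<zero>"
  shows "internal_direct_sum G I N"
  unfolding internal_direct_sum_def
proof (intro conjI ballI sub)
  fix x assume x: "x \<in> carrier G"
  have N: "\<zero> \<in> N i \<and> N i \<subseteq> carrier G" if "i \<in> I" for i
    using sub[OF that] additive_subgroup.zero_closed additive_subgroup.a_subset by blast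
  have "\<exists>f. is_decomposition G I N x f"
    using ex[OF x] is_decompositionI[of _ I _ N x] N by blast
  moreover have "f = f'" if f: "is_decomposition G I N x f" and f': "is_decomposition G I N x f'"
    for f f'
  proof (rule ext)
    fix i
    define F where "F = {i \<in> I. f i \<noteq> \<zero>} \<union> {i \<in> I. f' i \<noteq> \<zero>}"
    have F: "finite F" "F \<subseteq> I" and fE: "f \<in> Pi\<^sub>E I N" "f' \<in> Pi\<^sub>E I N"
      using f f' unfolding is_decomposition_def F_def by auto
    have c: "f i \<in> carrier G" "f' i \<in> carrier G" if "i \<in> F" for i
      using N fE that F(2) by fastforce+
    \<comment> \<open>Writing \<open>f\<close> as a sum rather than negating \<open>f'\<close> lets
      additivity of finite sums give \<open>finsum (f - f') + x = x\<close>.\<close>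
    have split: "f i = (f i \<ominus> f' i) \<oplus> f' i" if "i \<in> F" for i
      using c[OF that] by (simp add: minus_eq a_assoc l_neg)
    have "finsum G f F = x" "finsum G f' F = x"
      by (rule finsum_decomposition; use f f' F c in \<open>auto simp: F_def\<close>)+
    moreover have "finsum G f F = finsum G (\<lambda>i. (f i \<ominus> f' i) \<oplus> f' i) F"
      by (rule add.finprod_cong') (use split c in auto)
    moreover have "\<dots> = finsum G (\<lambda>i. f i \<ominus> f' i) F \<oplus> finsum G f' F"
      by (rule finsum_addf) (use c in auto)
    moreover have "finsum G (\<lambda>i. f i \<ominus> f' i) F \<in> carrier G"
      using c by (intro finsum_closed) auto
    ultimately have 0: "finsum G (\<lambda>i. f i \<ominus> f' i) F = \<zero>"
      using x by simp
    have P: "(\<lambda>i. f i \<ominus> f' i) \<in> Pi F N"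
    proof
      fix i assume "i \<in> F"
      then have i: "i \<in> I" using F(2) by blast
      then interpret additive_subgroup "N i" G by (rule sub)
      show "f i \<ominus> f' i \<in> N i"
        using fE i unfolding a_minus_def by (intro a_closed a_inv_closed) auto
    qed
    show "f i = f' i"
    proof (cases "i \<in> F")
      case True
      then show ?thesis using indep[OF F P 0 True] split[OF True] c by simp
    next
      case False
      then show ?thesis using fE by (cases "i \<in> I") (auto simp: F_def PiE_def extensional_def)
    qed
  qed
  ultimately show "\<exists>!f. is_decomposition G I N x f" by blast
qed


section \<open>Homogeneous components\<close>

context graded_ring
begin

text \<open>Decompositions are extensional, so for \<open>x\<close> in the carrier the whole
  function \<open>\<lambda>g. hcomp g x\<close> is itself the decomposition of \<open>x\<close>,
  including its value \<open>undefined\<close> outside \<open>carrier G\<close>.\<close>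

definition hcomp :: "'g \<Rightarrow> 'r \<Rightarrow> 'r" where
  "hcomp g x = (THE f. is_decomposition R (carrier G) A x f) g"

definition hsupp :: "'r \<Rightarrow> 'g set" where
  "hsupp x = {g \<in> carrier G. hcomp g x \<noteq> \<zero>\<^bsub>R\<^esub>}"

lemma homog_subgroup: "g \<in> carrier G \<Longrightarrow> additive_subgroup (A g) R"
  using direct_sum unfolding internal_direct_sum_def by blast

lemma homog_closed [simp]: "\<lbrakk>x \<in> A g; g \<in> carrier G\<rbrakk> \<Longrightarrow> x \<in> carrier R"
  using homog_subgroup additive_subgroup.a_subset by blast

lemma homog_zero [simp]: "g \<in> carrier G \<Longrightarrow> \<zero>\<^bsub>R\<^esub> \<in> A g"
  using homog_subgroup additive_subgroup.zero_closed by blast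

lemma homog_add: "\<lbrakk>x \<in> A g; y \<in> A g; g \<in> carrier G\<rbrakk> \<Longrightarrow> x \<oplus>\<^bsub>R\<^esub> y \<in> A g"
  by (intro additive_subgroup.a_closed homog_subgroup)

lemma homog_minus: "\<lbrakk>x \<in> A g; y \<in> A g; g \<in> carrier G\<rbrakk> \<Longrightarrow> x \<ominus>\<^bsub>R\<^esub> y \<in> A g"
  unfolding a_minus_def
  by (intro additive_subgroup.a_closed additive_subgroup.a_inv_closed homog_subgroup)

lemma decomposition_hcomp:
  "x \<in> carrier R \<Longrightarrow> is_decomposition R (carrier G) A x (\<lambda>g. hcomp g x)"
  using direct_sum theI'[of "is_decomposition R (carrier G) A x"]
  unfolding internal_direct_sum_def hcomp_def by simp

lemma hcomp_unique:
  assumes "x \<in> carrier R" "is_decomposition R (carrier G) A x f"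
  shows "hcomp g x = f g"
proof -
  have "\<exists>!f. is_decomposition R (carrier G) A x f"
    using direct_sum assms(1) unfolding internal_direct_sum_def by blast
  then have "(\<lambda>g. hcomp g x) = f"
    using decomposition_hcomp[OF assms(1)] assms(2) by blast
  then show ?thesis by (rule fun_cong)
qed

lemma hcomp_homog: "\<lbrakk>x \<in> carrier R; g \<in> carrier G\<rbrakk> \<Longrightarrow> hcomp g x \<in> A g"
  using decomposition_hcomp unfolding is_decomposition_def by blast

lemma hcomp_closed [simp]: "\<lbrakk>x \<in> carrier R; g \<in> carrier G\<rbrakk> \<Longrightarrow> hcomp g x \<in> carrier R"
  using hcomp_homog homog_closed by blast

lemma finite_hsupp: "x \<in> carrier R \<Longrightarrow> finite (hsupp x)"
  using decomposition_hcomp unfolding is_decomposition_def hsupp_def by blast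

lemma hsupp_subset: "hsupp x \<subseteq> carrier G"
  unfolding hsupp_def by blast

lemma finsum_hcomp:
  assumes "x \<in> carrier R" "finite F" "hsupp x \<subseteq> F" "F \<subseteq> carrier G"
  shows "finsum R (\<lambda>g. hcomp g x) F = x"
  by (rule R.finsum_decomposition[OF decomposition_hcomp])
    (use assms in \<open>auto simp: hsupp_def\<close>)

lemma homog_family_closed: "\<lbrakk>F \<subseteq> carrier G; z \<in> Pi F A\<rbrakk> \<Longrightarrow> z \<in> F \<rightarrow> carrier R"
  using homog_closed by blast

lemma hcomp_finsum:
  assumes "finite F" "F \<subseteq> carrier G" "z \<in> Pi F A" "g \<in> carrier G"
  shows "hcomp g (finsum R z F) = (if g \<in> F then z g else \<zero>\<^bsub>R\<^esub>)"
proof -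
  have "is_decomposition R (carrier G) A (finsum R z F) (\<lambda>i\<in>carrier G. if i \<in> F then z i else \<zero>\<^bsub>R\<^esub>)"
    by (rule R.is_decompositionI) (use assms homog_closed in auto)
  with homog_family_closed[OF assms(2,3)] show ?thesis
    using hcomp_unique[of "finsum R z F"] assms by auto
qed

lemma hcomp_of_homog:
  assumes "x \<in> A g" "g \<in> carrier G" "h \<in> carrier G"
  shows "hcomp h x = (if h = g then x else \<zero>\<^bsub>R\<^esub>)"
  using hcomp_finsum[of "{g}" "\<lambda>_. x" h] assms by auto

lemma hcomp_zero [simp]: "g \<in> carrier G \<Longrightarrow> hcomp g \<zero>\<^bsub>R\<^esub> = \<zero>\<^bsub>R\<^esub>"
  using hcomp_of_homog[of "\<zero>\<^bsub>R\<^esub>" g g] by simp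

lemma hcomp_add:
  assumes "x \<in> carrier R" "y \<in> carrier R" "g \<in> carrier G"
  shows "hcomp g (x \<oplus>\<^bsub>R\<^esub> y) = hcomp g x \<oplus>\<^bsub>R\<^esub> hcomp g y"
proof -
  let ?F = "hsupp x \<union> hsupp y"
  have F: "finite ?F" "?F \<subseteq> carrier G" using assms finite_hsupp hsupp_subset by auto
  have c: "(\<lambda>g. hcomp g z) \<in> ?F \<rightarrow> carrier R" if "z \<in> carrier R" for z
    using F that by auto
  have P: "(\<lambda>g. hcomp g x \<oplus>\<^bsub>R\<^esub> hcomp g y) \<in> Pi ?F A"
  proof
    fix k assume "k \<in> ?F"
    then have "k \<in> carrier G" using F(2) by blast
    then show "hcomp k x \<oplus>\<^bsub>R\<^esub> hcomp k y \<in> A k" using hcomp_homog homog_add assms by simp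
  qed
  have "x \<oplus>\<^bsub>R\<^esub> y = finsum R (\<lambda>g. hcomp g x) ?F \<oplus>\<^bsub>R\<^esub> finsum R (\<lambda>g. hcomp g y) ?F"
    using finsum_hcomp[OF assms(1) F(1) _ F(2)] finsum_hcomp[OF assms(2) F(1) _ F(2)] by simp
  also have "\<dots> = finsum R (\<lambda>g. hcomp g x \<oplus>\<^bsub>R\<^esub> hcomp g y) ?F"
    using c assms R.finsum_addf by simp
  finally have "hcomp g (x \<oplus>\<^bsub>R\<^esub> y) = (if g \<in> ?F then hcomp g x \<oplus>\<^bsub>R\<^esub> hcomp g y else \<zero>\<^bsub>R\<^esub>)"
    using hcomp_finsum[OF F P assms(3)] by simp
  then show ?thesis using assms(3) by (auto simp: hsupp_def)
qed

lemma hcomp_minus: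
  assumes "x \<in> carrier R" "y \<in> carrier R" "g \<in> carrier G"
  shows "hcomp g (x \<ominus>\<^bsub>R\<^esub> y) = hcomp g x \<ominus>\<^bsub>R\<^esub> hcomp g y"
proof -
  have "(x \<ominus>\<^bsub>R\<^esub> y) \<oplus>\<^bsub>R\<^esub> y = x" using assms by (simp add: R.minus_eq R.a_assoc R.l_neg)
  then have "hcomp g x = hcomp g (x \<ominus>\<^bsub>R\<^esub> y) \<oplus>\<^bsub>R\<^esub> hcomp g y"
    using hcomp_add[of "x \<ominus>\<^bsub>R\<^esub> y" y g] assms by simp
  then show ?thesis using assms by (simp add: R.minus_eq R.a_assoc R.r_neg)
qed

lemma nonzero_hcomp:
  assumes "x \<in> carrier R" "x \<noteq> \<zero>\<^bsub>R\<^esub>"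
  obtains g where "g \<in> carrier G" "hcomp g x \<noteq> \<zero>\<^bsub>R\<^esub>"
proof -
  have "hsupp x \<noteq> {}" using finsum_hcomp[OF assms(1), of "{}"] assms by auto
  then show ?thesis using that unfolding hsupp_def by blast
qed

text \<open>Right translation by \<open>h\<close> is injective on the group, so multiplying the
  decomposition of \<open>x\<close> by \<open>y\<close> relabels the degrees without merging any two
  of them.\<close>

lemma hcomp_mult_homog:
  assumes "x \<in> carrier R" "y \<in> A h" "h \<in> carrier G" "g \<in> carrier G"
  shows "hcomp (g \<otimes>\<^bsub>G\<^esub> h) (x \<otimes>\<^bsub>R\<^esub> y) = hcomp g x \<otimes>\<^bsub>R\<^esub> y"
proof -
  let ?F = "hsupp x"
  have F: "finite ?F" "?F \<subseteq> carrier G" using assms finite_hsupp hsupp_subset by auto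
  have y: "y \<in> carrier R" using assms by simp
  have P: "(\<lambda>k. hcomp (k \<otimes>\<^bsub>G\<^esub> inv\<^bsub>G\<^esub> h) x \<otimes>\<^bsub>R\<^esub> y) \<in> Pi ((\<lambda>k. k \<otimes>\<^bsub>G\<^esub> h) ` ?F) A"
    using graded_mult[of _ h _ y] hcomp_homog F(2) assms by (auto simp: G.m_assoc)
  have sub: "(\<lambda>k. k \<otimes>\<^bsub>G\<^esub> h) ` ?F \<subseteq> carrier G" using F(2) assms(3) by auto
  have inj: "inj_on (\<lambda>k. k \<otimes>\<^bsub>G\<^esub> h) (carrier G)"
    using assms(3) by (auto intro: inj_onI)
  have "x \<otimes>\<^bsub>R\<^esub> y = finsum R (\<lambda>k. hcomp k x) ?F \<otimes>\<^bsub>R\<^esub> y"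
    using finsum_hcomp[OF assms(1) F(1) _ F(2)] by simp
  also have "\<dots> = finsum R (\<lambda>k. hcomp k x \<otimes>\<^bsub>R\<^esub> y) ?F"
    by (rule R.finsum_ldistr) (use F assms y in auto)
  \<comment> \<open>Inserting \<open>h\<close> and its inverse turns the summand into a function of
    the translated index, as reindexing requires.\<close>
  also have "\<dots> = finsum R (\<lambda>k. hcomp (k \<otimes>\<^bsub>G\<^esub> h \<otimes>\<^bsub>G\<^esub> inv\<^bsub>G\<^esub> h) x \<otimes>\<^bsub>R\<^esub> y) ?F"
    by (rule R.add.finprod_cong') (use F assms y in \<open>auto simp: G.m_assoc\<close>)
  also have "\<dots> = finsum R (\<lambda>k. hcomp (k \<otimes>\<^bsub>G\<^esub> inv\<^bsub>G\<^esub> h) x \<otimes>\<^bsub>R\<^esub> y) ((\<lambda>k. k \<otimes>\<^bsub>G\<^esub> h) ` ?F)"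
    by (rule R.finsum_reindex[symmetric])
      (use F assms y inj in \<open>auto intro: inj_on_subset\<close>)
  finally have "hcomp (g \<otimes>\<^bsub>G\<^esub> h) (x \<otimes>\<^bsub>R\<^esub> y) =
      (if g \<otimes>\<^bsub>G\<^esub> h \<in> (\<lambda>k. k \<otimes>\<^bsub>G\<^esub> h) ` ?F then hcomp (g \<otimes>\<^bsub>G\<^esub> h \<otimes>\<^bsub>G\<^esub> inv\<^bsub>G\<^esub> h) x \<otimes>\<^bsub>R\<^esub> y else \<zero>\<^bsub>R\<^esub>)"
    using hcomp_finsum[OF finite_imageI[OF F(1)] sub P, of "g \<otimes>\<^bsub>G\<^esub> h"] assms by simp
  moreover have "g \<otimes>\<^bsub>G\<^esub> h \<in> (\<lambda>k. k \<otimes>\<^bsub>G\<^esub> h) ` ?F \<longleftrightarrow> g \<in> ?F"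
    using inj F assms by (meson inj_on_image_mem_iff)
  ultimately show ?thesis
    using assms y by (auto simp: G.m_assoc hsupp_def)
qed

text \<open>The mirror image, with left translation; neither the group nor the ring is commutative,
  so it is a separate computation.\<close>

lemma hcomp_homog_mult:
  assumes "x \<in> carrier R" "y \<in> A h" "h \<in> carrier G" "g \<in> carrier G"
  shows "hcomp (h \<otimes>\<^bsub>G\<^esub> g) (y \<otimes>\<^bsub>R\<^esub> x) = y \<otimes>\<^bsub>R\<^esub> hcomp g x"
proof -
  let ?F = "hsupp x"
  have F: "finite ?F" "?F \<subseteq> carrier G" using assms finite_hsupp hsupp_subset by auto
  have y: "y \<in> carrier R" using assms by simp
  have cancel: "inv\<^bsub>G\<^esub> h \<otimes>\<^bsub>G\<^esub> (h \<otimes>\<^bsub>G\<^esub> k) = k" if "k \<in> carrier G" for k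
    using that assms by (simp add: G.m_assoc[symmetric])
  have P: "(\<lambda>k. y \<otimes>\<^bsub>R\<^esub> hcomp (inv\<^bsub>G\<^esub> h \<otimes>\<^bsub>G\<^esub> k) x) \<in> Pi ((\<lambda>k. h \<otimes>\<^bsub>G\<^esub> k) ` ?F) A"
    using graded_mult[of h _ y] hcomp_homog F(2) assms cancel by auto
  have sub: "(\<lambda>k. h \<otimes>\<^bsub>G\<^esub> k) ` ?F \<subseteq> carrier G" using F(2) assms(3) by auto
  have inj: "inj_on (\<lambda>k. h \<otimes>\<^bsub>G\<^esub> k) (carrier G)"
    using assms(3) by (auto intro: inj_onI)
  have "y \<otimes>\<^bsub>R\<^esub> x = y \<otimes>\<^bsub>R\<^esub> finsum R (\<lambda>k. hcomp k x) ?F"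
    using finsum_hcomp[OF assms(1) F(1) _ F(2)] by simp
  also have "\<dots> = finsum R (\<lambda>k. y \<otimes>\<^bsub>R\<^esub> hcomp k x) ?F"
    by (rule R.finsum_rdistr) (use F assms y in auto)
  also have "\<dots> = finsum R (\<lambda>k. y \<otimes>\<^bsub>R\<^esub> hcomp (inv\<^bsub>G\<^esub> h \<otimes>\<^bsub>G\<^esub> (h \<otimes>\<^bsub>G\<^esub> k)) x) ?F"
    by (rule R.add.finprod_cong') (use F assms y cancel in auto)
  also have "\<dots> = finsum R (\<lambda>k. y \<otimes>\<^bsub>R\<^esub> hcomp (inv\<^bsub>G\<^esub> h \<otimes>\<^bsub>G\<^esub> k) x) ((\<lambda>k. h \<otimes>\<^bsub>G\<^esub> k) ` ?F)"
    by (rule R.finsum_reindex[symmetric])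
      (use F assms y inj in \<open>auto intro: inj_on_subset\<close>)
  finally have "hcomp (h \<otimes>\<^bsub>G\<^esub> g) (y \<otimes>\<^bsub>R\<^esub> x) =
      (if h \<otimes>\<^bsub>G\<^esub> g \<in> (\<lambda>k. h \<otimes>\<^bsub>G\<^esub> k) ` ?F then y \<otimes>\<^bsub>R\<^esub> hcomp (inv\<^bsub>G\<^esub> h \<otimes>\<^bsub>G\<^esub> (h \<otimes>\<^bsub>G\<^esub> g)) x else \<zero>\<^bsub>R\<^esub>)"
    using hcomp_finsum[OF finite_imageI[OF F(1)] sub P, of "h \<otimes>\<^bsub>G\<^esub> g"] assms by simp
  moreover have "h \<otimes>\<^bsub>G\<^esub> g \<in> (\<lambda>k. h \<otimes>\<^bsub>G\<^esub> k) ` ?F \<longleftrightarrow> g \<in> ?F"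
    using inj F assms by (meson inj_on_image_mem_iff)
  ultimately show ?thesis
    using assms y cancel by (auto simp: hsupp_def)
qed

text \<open>The component of degree \<^term>\<open>\<one>\<^bsub>G\<^esub>\<close> of the unit is a left unit for homogeneous
  elements, hence for all elements.\<close>

lemma one_homog: "\<one>\<^bsub>R\<^esub> \<in> A \<one>\<^bsub>G\<^esub>"
proof -
  let ?e = "hcomp \<one>\<^bsub>G\<^esub> \<one>\<^bsub>R\<^esub>"
  have e: "?e \<in> carrier R" by simp
  have h: "?e \<otimes>\<^bsub>R\<^esub> y = y" if "y \<in> A h" "h \<in> carrier G" for y h
    using hcomp_mult_homog[OF R.one_closed that G.one_closed] hcomp_of_homog[OF that that(2)] that
    by simp
  let ?F = "hsupp \<one>\<^bsub>R\<^esub>"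
  have F: "finite ?F" "?F \<subseteq> carrier G" using finite_hsupp hsupp_subset by auto
  have s: "finsum R (\<lambda>k. hcomp k \<one>\<^bsub>R\<^esub>) ?F = \<one>\<^bsub>R\<^esub>"
    using finsum_hcomp[OF R.one_closed F(1) _ F(2)] by simp
  have "?e = ?e \<otimes>\<^bsub>R\<^esub> finsum R (\<lambda>k. hcomp k \<one>\<^bsub>R\<^esub>) ?F" using s e by simp
  also have "\<dots> = finsum R (\<lambda>k. ?e \<otimes>\<^bsub>R\<^esub> hcomp k \<one>\<^bsub>R\<^esub>) ?F"
    by (rule R.finsum_rdistr) (use F e in auto)
  also have "\<dots> = finsum R (\<lambda>k. hcomp k \<one>\<^bsub>R\<^esub>) ?F"
  proof (rule R.add.finprod_cong')
    fix k assume "k \<in> ?F"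
    then have "k \<in> carrier G" using F(2) by blast
    then show "?e \<otimes>\<^bsub>R\<^esub> hcomp k \<one>\<^bsub>R\<^esub> = hcomp k \<one>\<^bsub>R\<^esub>" using h hcomp_homog R.one_closed by blast
  qed (use F in auto)
  finally have "?e = \<one>\<^bsub>R\<^esub>" using s by simp
  then show ?thesis using hcomp_homog[OF R.one_closed G.one_closed] by simp
qed

end

section \<open>Graded left ideals\<close>

context ring
begin

lemma left_idealI:
  assumes "L \<subseteq> carrier R" "\<zero> \<in> L"
    and add: "\<And>x y. \<lbrakk>x \<in> L; y \<in> L\<rbrakk> \<Longrightarrow> x \<oplus> y \<in> L"
    and mult: "\<And>r x. \<lbrakk>r \<in> carrier R; x \<in> L\<rbrakk> \<Longrightarrow> r \<otimes> x \<in> L"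
  shows "left_ideal L R"
proof -
  have "\<ominus> x \<in> L" if "x \<in> L" for x
    using mult[of "\<ominus> \<one>" x] that assms(1) by (auto simp: l_minus)
  then have "subgroup L (add_monoid R)"
    using assms by (intro add.subgroupI) (auto simp: a_inv_def)
  then show ?thesis
    using mult ring_axioms
    by (auto intro!: left_ideal.intro additive_subgroupI simp: left_ideal_axioms_def)
qed

lemma left_ideal_subset: "left_ideal L R \<Longrightarrow> L \<subseteq> carrier R"
  by (rule additive_subgroup.a_subset[OF left_ideal.axioms(1)])

lemma left_ideal_zero: "left_ideal L R \<Longrightarrow> \<zero> \<in> L"
  by (rule additive_subgroup.zero_closed[OF left_ideal.axioms(1)])

lemma left_ideal_add: "\<lbrakk>left_ideal L R; x \<in> L; y \<in> L\<rbrakk> \<Longrightarrow> x \<oplus> y \<in> L"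
  by (rule additive_subgroup.a_closed[OF left_ideal.axioms(1)])

lemma left_ideal_minus: "\<lbrakk>left_ideal L R; x \<in> L; y \<in> L\<rbrakk> \<Longrightarrow> x \<ominus> y \<in> L"
  unfolding a_minus_def
  by (intro left_ideal_add additive_subgroup.a_inv_closed[OF left_ideal.axioms(1)])

lemma left_ideal_mult: "\<lbrakk>left_ideal L R; x \<in> L; r \<in> carrier R\<rbrakk> \<Longrightarrow> r \<otimes> x \<in> L"
  by (rule left_ideal.l_mult_closed)

lemma left_ideal_finsum:
  assumes "left_ideal L R" "z \<in> F \<rightarrow> L"
  shows "finsum R z F \<in> L"
  using assms(2)
proof (induction F rule: infinite_finite_induct)
  case (insert i F)
  moreover have "z \<in> F \<rightarrow> carrier R" "z i \<in> carrier R"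
    using insert.prems left_ideal_subset[OF assms(1)] by auto
  ultimately show ?case
    using left_ideal_add[OF assms(1)] by simp
qed (simp_all add: left_ideal_zero[OF assms(1)])

lemma left_ideal_eq_carrier: "\<lbrakk>left_ideal L R; \<one> \<in> L\<rbrakk> \<Longrightarrow> L = carrier R"
  using left_ideal_mult[of L \<one>] left_ideal_subset by fastforce

lemma left_ideal_left_annihilator:
  "x \<in> carrier R \<Longrightarrow> left_ideal (left_annihilator R x) R"
  by (rule left_idealI) (auto simp: left_annihilator_def l_distr m_assoc)

text \<open>The inverse is suggested by the geometric series: \<open>1 + a b + a b a b + ...\<close>
  equals \<open>1 + a (1 + b a + ...) b\<close>, and \<open>c\<close> stands for the inner series.
  It serves to make the radical closed under right multiplication and to pass from
  \<open>1 - x r\<close> to \<open>1 - r x\<close>.\<close>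

lemma one_minus_swap:
  assumes [simp]: "a \<in> carrier R" "b \<in> carrier R" "c \<in> carrier R"
    and c: "c \<otimes> (\<one> \<ominus> b \<otimes> a) = \<one>"
  shows "(\<one> \<oplus> a \<otimes> c \<otimes> b) \<otimes> (\<one> \<ominus> a \<otimes> b) = \<one>"
proof -
  have "(\<one> \<oplus> a \<otimes> c \<otimes> b) \<otimes> (\<one> \<ominus> a \<otimes> b) = (\<one> \<ominus> a \<otimes> b) \<oplus> a \<otimes> (c \<otimes> (\<one> \<ominus> b \<otimes> a)) \<otimes> b"
    by (simp add: minus_eq l_distr r_distr l_minus r_minus m_assoc minus_add a_ac)
  also have "\<dots> = \<one>"
    unfolding c by (simp add: minus_eq a_assoc l_neg)
  finally show ?thesis .
qed

end

context graded_ring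
begin

text \<open>By uniqueness, a decomposition with all terms in \<open>L\<close> is the decomposition
  in the whole ring, so being graded amounts to closure under taking components.\<close>

lemma graded_left_ideal_iff:
  "graded_left_ideal G R A L \<longleftrightarrow>
    left_ideal L R \<and> (\<forall>x\<in>L. \<forall>g\<in>carrier G. hcomp g x \<in> L)"
proof (intro iffI conjI ballI)
  assume L: "graded_left_ideal G R A L"
  then show l: "left_ideal L R" unfolding graded_left_ideal_def by blast
  fix x g assume x: "x \<in> L" and g: "g \<in> carrier G"
  obtain f where f: "is_decomposition R (carrier G) (\<lambda>g. L \<inter> A g) x f"
    using L x unfolding graded_left_ideal_def by blast
  then have "is_decomposition R (carrier G) A x f"
    unfolding is_decomposition_def by auto
  then have "hcomp g x = f g" using hcomp_unique R.left_ideal_subset[OF l] x by blast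
  then show "hcomp g x \<in> L" using f g unfolding is_decomposition_def by auto
next
  assume L: "left_ideal L R \<and> (\<forall>x\<in>L. \<forall>g\<in>carrier G. hcomp g x \<in> L)"
  have "\<exists>f. is_decomposition R (carrier G) (\<lambda>g. L \<inter> A g) x f" if x: "x \<in> L" for x
  proof
    have xR: "x \<in> carrier R" using R.left_ideal_subset L x by blast
    have comp: "hcomp g x \<in> L \<inter> A g" if "g \<in> hsupp x" for g
      using that L x hcomp_homog[OF xR] hsupp_subset by blast
    show "is_decomposition R (carrier G) (\<lambda>g. L \<inter> A g) x
        (\<lambda>g\<in>carrier G. if g \<in> hsupp x then hcomp g x else \<zero>\<^bsub>R\<^esub>)"
      by (rule R.is_decompositionI)
        (use L xR comp finite_hsupp hsupp_subset R.left_ideal_zero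
          finsum_hcomp[OF xR finite_hsupp[OF xR] order_refl hsupp_subset] in auto)
  qed
  with L show "graded_left_ideal G R A L" unfolding graded_left_ideal_def by blast
qed

lemma graded_left_idealD:
  assumes "graded_left_ideal G R A L"
  shows "left_ideal L R" and "\<lbrakk>x \<in> L; g \<in> carrier G\<rbrakk> \<Longrightarrow> hcomp g x \<in> L"
  using assms graded_left_ideal_iff by blast+

lemma graded_left_ideal_zero: "graded_left_ideal G R A {\<zero>\<^bsub>R\<^esub>}"
  unfolding graded_left_ideal_iff by (auto intro!: R.left_idealI)

lemma graded_left_ideal_left_annihilator:
  assumes "a \<in> A h" "h \<in> carrier G"
  shows "graded_left_ideal G R A (left_annihilator R a)"
  unfolding graded_left_ideal_iff
proof (intro conjI ballI R.left_ideal_left_annihilator)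
  show "a \<in> carrier R" using assms by simp
  fix x g assume x: "x \<in> left_annihilator R a" and g: "g \<in> carrier G"
  then have xR: "x \<in> carrier R" "x \<otimes>\<^bsub>R\<^esub> a = \<zero>\<^bsub>R\<^esub>" by (simp_all add: left_annihilator_def)
  then have "hcomp g x \<otimes>\<^bsub>R\<^esub> a = \<zero>\<^bsub>R\<^esub>"
    using hcomp_mult_homog[OF xR(1) assms g] g assms(2) by simp
  then show "hcomp g x \<in> left_annihilator R a"
    using xR(1) g by (simp add: left_annihilator_def)
qed

text \<open>This is the sum \<open>L + R a\<close>; with \<open>L\<close> the zero ideal it is the
  principal left ideal of \<open>a\<close>, as used for the radical.\<close>

definition adjoin :: "'r set \<Rightarrow> 'r \<Rightarrow> 'r set" where
  "adjoin L a = {x \<oplus>\<^bsub>R\<^esub> r \<otimes>\<^bsub>R\<^esub> a | x r. x \<in> L \<and> r \<in> carrier R}"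

lemma adjoinI: "\<lbrakk>x \<in> L; r \<in> carrier R\<rbrakk> \<Longrightarrow> x \<oplus>\<^bsub>R\<^esub> r \<otimes>\<^bsub>R\<^esub> a \<in> adjoin L a"
  unfolding adjoin_def by blast

lemma subset_adjoin:
  assumes "left_ideal L R" "a \<in> carrier R"
  shows "L \<subseteq> adjoin L a"
proof
  fix x assume x: "x \<in> L"
  then show "x \<in> adjoin L a"
    using adjoinI[OF x R.zero_closed, of a] R.left_ideal_subset[OF assms(1)] assms(2) by auto
qed

lemma self_in_adjoin:
  assumes "left_ideal L R" "a \<in> carrier R"
  shows "a \<in> adjoin L a"
  using adjoinI[OF R.left_ideal_zero[OF assms(1)] R.one_closed, of a] assms(2) by simp

lemma graded_left_ideal_adjoin:
  assumes L: "graded_left_ideal G R A L" and a: "a \<in> A h" "h \<in> carrier G"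
  shows "graded_left_ideal G R A (adjoin L a)"
  unfolding graded_left_ideal_iff
proof (intro conjI ballI R.left_idealI)
  note l = graded_left_idealD(1)[OF L]
  have LR: "\<And>x. x \<in> L \<Longrightarrow> x \<in> carrier R" using R.left_ideal_subset[OF l] by blast
  have aR: "a \<in> carrier R" using a by simp
  show "adjoin L a \<subseteq> carrier R" unfolding adjoin_def using LR aR by auto
  show "\<zero>\<^bsub>R\<^esub> \<in> adjoin L a" using subset_adjoin[OF l aR] R.left_ideal_zero[OF l] by blast
  show "x \<oplus>\<^bsub>R\<^esub> y \<in> adjoin L a" if xy: "x \<in> adjoin L a" "y \<in> adjoin L a" for x y
  proof -
    obtain u r v s where *: "u \<in> L" "r \<in> carrier R" "x = u \<oplus>\<^bsub>R\<^esub> r \<otimes>\<^bsub>R\<^esub> a"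
      "v \<in> L" "s \<in> carrier R" "y = v \<oplus>\<^bsub>R\<^esub> s \<otimes>\<^bsub>R\<^esub> a"
      using xy unfolding adjoin_def by blast
    then have "x \<oplus>\<^bsub>R\<^esub> y = (u \<oplus>\<^bsub>R\<^esub> v) \<oplus>\<^bsub>R\<^esub> (r \<oplus>\<^bsub>R\<^esub> s) \<otimes>\<^bsub>R\<^esub> a"
      using LR aR by (simp add: R.l_distr R.a_ac)
    then show ?thesis using adjoinI[of "u \<oplus>\<^bsub>R\<^esub> v" L "r \<oplus>\<^bsub>R\<^esub> s" a] * R.left_ideal_add[OF l] by simp
  qed
  show "r \<otimes>\<^bsub>R\<^esub> x \<in> adjoin L a" if rx: "r \<in> carrier R" "x \<in> adjoin L a" for r x
  proof -
    obtain v s where *: "v \<in> L" "s \<in> carrier R" "x = v \<oplus>\<^bsub>R\<^esub> s \<otimes>\<^bsub>R\<^esub> a"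
      using rx unfolding adjoin_def by blast
    then have "r \<otimes>\<^bsub>R\<^esub> x = r \<otimes>\<^bsub>R\<^esub> v \<oplus>\<^bsub>R\<^esub> (r \<otimes>\<^bsub>R\<^esub> s) \<otimes>\<^bsub>R\<^esub> a"
      using LR aR rx by (simp add: R.r_distr R.m_assoc)
    then show ?thesis
      using adjoinI[of "r \<otimes>\<^bsub>R\<^esub> v" L "r \<otimes>\<^bsub>R\<^esub> s" a] * rx R.left_ideal_mult[OF l] by simp
  qed
  show "hcomp g x \<in> adjoin L a" if x: "x \<in> adjoin L a" and g: "g \<in> carrier G" for g x
  proof -
    obtain v s where *: "v \<in> L" "s \<in> carrier R" "x = v \<oplus>\<^bsub>R\<^esub> s \<otimes>\<^bsub>R\<^esub> a"
      using x unfolding adjoin_def by blast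
    \<comment> \<open>Homogeneity of \<open>a\<close> enters here: the component of
      \<open>s a\<close> in degree \<open>g\<close> comes from the single component of
      \<open>s\<close> in degree \<open>g\<close> times the inverse of \<open>h\<close>.\<close>
    have "g = g \<otimes>\<^bsub>G\<^esub> inv\<^bsub>G\<^esub> h \<otimes>\<^bsub>G\<^esub> h" using g a(2) by (simp add: G.m_assoc)
    then have "hcomp g (s \<otimes>\<^bsub>R\<^esub> a) = hcomp (g \<otimes>\<^bsub>G\<^esub> inv\<^bsub>G\<^esub> h) s \<otimes>\<^bsub>R\<^esub> a"
      using hcomp_mult_homog[OF *(2) a, of "g \<otimes>\<^bsub>G\<^esub> inv\<^bsub>G\<^esub> h"] g a(2) by simp
    then have "hcomp g x = hcomp g v \<oplus>\<^bsub>R\<^esub> hcomp (g \<otimes>\<^bsub>G\<^esub> inv\<^bsub>G\<^esub> h) s \<otimes>\<^bsub>R\<^esub> a"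
      using * LR aR g hcomp_add by simp
    then show ?thesis
      using adjoinI[of "hcomp g v" L "hcomp (g \<otimes>\<^bsub>G\<^esub> inv\<^bsub>G\<^esub> h) s" a] * g a(2)
        graded_left_idealD(2)[OF L] by simp
  qed
qed

section \<open>Zorn's lemma for graded left ideals\<close>

lemma graded_left_ideal_Union_chain:
  assumes C: "\<C> \<noteq> {}" "subset.chain {L. graded_left_ideal G R A L} \<C>"
  shows "graded_left_ideal G R A (\<Union>\<C>)"
proof -
  have gr: "graded_left_ideal G R A L" if "L \<in> \<C>" for L
    using C(2) that unfolding subset.chain_def by blast
  note l = graded_left_idealD(1)[OF gr]
  have "x \<oplus>\<^bsub>R\<^esub> y \<in> \<Union>\<C>" if xy: "x \<in> \<Union>\<C>" "y \<in> \<Union>\<C>" for x y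
  proof -
    obtain L M where LM: "L \<in> \<C>" "M \<in> \<C>" "x \<in> L" "y \<in> M" using xy by blast
    then have "L \<subseteq> M \<or> M \<subseteq> L" using C(2) unfolding subset.chain_def by blast
    then show ?thesis
      using LM R.left_ideal_add[OF l[OF LM(1)]] R.left_ideal_add[OF l[OF LM(2)]] by blast
  qed
  note add = this
  have sub: "\<Union>\<C> \<subseteq> carrier R" using R.left_ideal_subset[OF l] by blast
  have zero: "\<zero>\<^bsub>R\<^esub> \<in> \<Union>\<C>" using R.left_ideal_zero[OF l] C(1) by blast
  have mult: "r \<otimes>\<^bsub>R\<^esub> x \<in> \<Union>\<C>" if "r \<in> carrier R" "x \<in> \<Union>\<C>" for r x
    using that R.left_ideal_mult[OF l] by blast
  have "hcomp g x \<in> \<Union>\<C>" if "x \<in> \<Union>\<C>" "g \<in> carrier G" for g x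
    using that graded_left_idealD(2)[OF gr] by blast
  then show ?thesis
    using R.left_idealI[OF sub zero add mult] unfolding graded_left_ideal_iff by blast
qed

text \<open>One application of Zorn's lemma covers two uses: \<open>S\<close> consisting of the unit
  gives maximal graded left ideals, and \<open>S\<close> consisting of the nonzero elements of an
  annihilator gives a graded complement of it.\<close>

lemma maximal_avoiding_graded_left_ideal:
  assumes L: "graded_left_ideal G R A L" and S: "L \<inter> S = {}"
  obtains K where "graded_left_ideal G R A K" "L \<subseteq> K" "K \<inter> S = {}"
    "\<And>K'. \<lbrakk>graded_left_ideal G R A K'; K \<subseteq> K'; K' \<inter> S = {}\<rbrakk> \<Longrightarrow> K' = K"
proof -
  let ?P = "{K. graded_left_ideal G R A K \<and> L \<subseteq> K \<and> K \<inter> S = {}}"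
  have "\<exists>M\<in>?P. \<forall>X\<in>?P. M \<subseteq> X \<longrightarrow> X = M"
  proof (rule subset_Zorn_nonempty)
    show "?P \<noteq> {}" using L S by blast
    fix \<C> assume C: "\<C> \<noteq> {}" "subset.chain ?P \<C>"
    then have sub: "\<C> \<subseteq> ?P" and "subset.chain {L. graded_left_ideal G R A L} \<C>"
      unfolding subset.chain_def by blast+
    then have "graded_left_ideal G R A (\<Union>\<C>)" using C(1) graded_left_ideal_Union_chain by blast
    moreover have "L \<subseteq> \<Union>\<C>" using sub C(1) by blast
    moreover have "\<Union>\<C> \<inter> S = {}" using sub by blast
    ultimately show "\<Union>\<C> \<in> ?P" by blast
  qed
  then obtain M where M: "M \<in> ?P" "\<forall>X\<in>?P. M \<subseteq> X \<longrightarrow> X = M" ..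
  show ?thesis
  proof (rule that)
    show "K' = M" if "graded_left_ideal G R A K'" "M \<subseteq> K'" "K' \<inter> S = {}" for K'
      using M(2)[rule_format, of K'] M(1) that by blast
  qed (use M(1) in blast)+
qed

end


section \<open>The graded Jacobson radical\<close>

context graded_ring
begin

abbreviation jac :: "'r set" where
  "jac \<equiv> gr_jacobson_radical G R A"

lemma ex_maximal_graded_left_ideal:
  assumes L: "graded_left_ideal G R A L" and "\<one>\<^bsub>R\<^esub> \<notin> L"
  obtains K where "maximal_graded_left_ideal G R A K" "L \<subseteq> K"
proof -
  from assms have "L \<inter> {\<one>\<^bsub>R\<^esub>} = {}" by blast
  then obtain K where K: "graded_left_ideal G R A K" "L \<subseteq> K" "K \<inter> {\<one>\<^bsub>R\<^esub>} = {}"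
    and max: "\<And>K'. \<lbrakk>graded_left_ideal G R A K'; K \<subseteq> K'; K' \<inter> {\<one>\<^bsub>R\<^esub>} = {}\<rbrakk> \<Longrightarrow> K' = K"
    using maximal_avoiding_graded_left_ideal[OF L] by metis
  have "maximal_graded_left_ideal G R A K"
    unfolding maximal_graded_left_ideal_def
  proof (intro conjI allI impI K(1))
    show "K \<noteq> carrier R" using K(3) by auto
    fix K' assume K': "graded_left_ideal G R A K' \<and> K \<subseteq> K'"
    show "K' = K \<or> K' = carrier R"
    proof (cases "\<one>\<^bsub>R\<^esub> \<in> K'")
      case True
      then show ?thesis using R.left_ideal_eq_carrier graded_left_idealD(1) K' by blast
    next
      case False
      then show ?thesis using max[of K'] K' by blast
    qed
  qed
  with K(2) show ?thesis using that by blast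
qed

lemma one_minus_homog:
  assumes "a \<in> A g" "b \<in> A (inv\<^bsub>G\<^esub> g)" "g \<in> carrier G"
  shows "\<one>\<^bsub>R\<^esub> \<ominus>\<^bsub>R\<^esub> b \<otimes>\<^bsub>R\<^esub> a \<in> A \<one>\<^bsub>G\<^esub>" "\<one>\<^bsub>R\<^esub> \<ominus>\<^bsub>R\<^esub> a \<otimes>\<^bsub>R\<^esub> b \<in> A \<one>\<^bsub>G\<^esub>"
proof -
  have "b \<otimes>\<^bsub>R\<^esub> a \<in> A \<one>\<^bsub>G\<^esub>" "a \<otimes>\<^bsub>R\<^esub> b \<in> A \<one>\<^bsub>G\<^esub>"
    using graded_mult[of "inv\<^bsub>G\<^esub> g" g b a] graded_mult[of g "inv\<^bsub>G\<^esub> g" a b] assms by simp_all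
  then show "\<one>\<^bsub>R\<^esub> \<ominus>\<^bsub>R\<^esub> b \<otimes>\<^bsub>R\<^esub> a \<in> A \<one>\<^bsub>G\<^esub>" "\<one>\<^bsub>R\<^esub> \<ominus>\<^bsub>R\<^esub> a \<otimes>\<^bsub>R\<^esub> b \<in> A \<one>\<^bsub>G\<^esub>"
    using homog_minus one_homog by auto
qed

text \<open>Graded form of the characterization of the radical by left invertibility. The degree of
  \<open>r\<close> is chosen so that \<open>1 - r a\<close> has degree one; then the left ideal it
  generates is graded, and a maximal graded left ideal can be found above it if it is
  proper.\<close>

lemma homog_mem_jac_iff:
  assumes a: "a \<in> A g" and g: "g \<in> carrier G"
  shows "a \<in> jac \<longleftrightarrow> (\<forall>r\<in>A (inv\<^bsub>G\<^esub> g). \<exists>c\<in>carrier R. c \<otimes>\<^bsub>R\<^esub> (\<one>\<^bsub>R\<^esub> \<ominus>\<^bsub>R\<^esub> r \<otimes>\<^bsub>R\<^esub> a) = \<one>\<^bsub>R\<^esub>)"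
proof (intro iffI ballI)
  have aR: "a \<in> carrier R" using a g by simp
  {
    fix r assume aJ: "a \<in> jac" and r: "r \<in> A (inv\<^bsub>G\<^esub> g)"
    let ?u = "\<one>\<^bsub>R\<^esub> \<ominus>\<^bsub>R\<^esub> r \<otimes>\<^bsub>R\<^esub> a"
    have rR: "r \<in> carrier R" using r g by simp
    then have uR: "?u \<in> carrier R" using aR by simp
    have gr: "graded_left_ideal G R A (adjoin {\<zero>\<^bsub>R\<^esub>} ?u)"
      using graded_left_ideal_adjoin[OF graded_left_ideal_zero] one_homog one_minus_homog(1)[OF a r g] by blast
    \<comment> \<open>Otherwise a maximal graded left ideal contains \<open>1 - r a\<close>, and
      also \<open>r a\<close> because \<open>a\<close> is in the radical, hence the unit.\<close>
    have "\<one>\<^bsub>R\<^esub> \<in> adjoin {\<zero>\<^bsub>R\<^esub>} ?u"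
    proof (rule ccontr)
      assume "\<one>\<^bsub>R\<^esub> \<notin> adjoin {\<zero>\<^bsub>R\<^esub>} ?u"
      with gr obtain K where K: "maximal_graded_left_ideal G R A K" "adjoin {\<zero>\<^bsub>R\<^esub>} ?u \<subseteq> K"
        by (rule ex_maximal_graded_left_ideal)
      then have l: "left_ideal K R" and ne: "K \<noteq> carrier R"
        unfolding maximal_graded_left_ideal_def using graded_left_idealD(1) by auto
      have "?u \<in> K"
        using K(2) self_in_adjoin[OF graded_left_idealD(1)[OF graded_left_ideal_zero] uR] by blast
      moreover have "r \<otimes>\<^bsub>R\<^esub> a \<in> K"
        using aJ K(1) R.left_ideal_mult[OF l _ rR] unfolding gr_jacobson_radical_def by blast
      ultimately have "?u \<oplus>\<^bsub>R\<^esub> r \<otimes>\<^bsub>R\<^esub> a \<in> K" by (rule R.left_ideal_add[OF l])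
      moreover have "?u \<oplus>\<^bsub>R\<^esub> r \<otimes>\<^bsub>R\<^esub> a = \<one>\<^bsub>R\<^esub>"
        using rR aR by (simp add: R.minus_eq R.a_assoc R.l_neg)
      ultimately show False using R.left_ideal_eq_carrier[OF l] ne by simp
    qed
    then obtain c where "c \<in> carrier R" "\<one>\<^bsub>R\<^esub> = \<zero>\<^bsub>R\<^esub> \<oplus>\<^bsub>R\<^esub> c \<otimes>\<^bsub>R\<^esub> ?u" unfolding adjoin_def by blast
    moreover have "\<zero>\<^bsub>R\<^esub> \<oplus>\<^bsub>R\<^esub> c \<otimes>\<^bsub>R\<^esub> ?u = c \<otimes>\<^bsub>R\<^esub> ?u" using \<open>c \<in> carrier R\<close> uR by simp
    ultimately show "\<exists>c\<in>carrier R. c \<otimes>\<^bsub>R\<^esub> ?u = \<one>\<^bsub>R\<^esub>" by metis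
  }
  assume inv: "\<forall>r\<in>A (inv\<^bsub>G\<^esub> g). \<exists>c\<in>carrier R. c \<otimes>\<^bsub>R\<^esub> (\<one>\<^bsub>R\<^esub> \<ominus>\<^bsub>R\<^esub> r \<otimes>\<^bsub>R\<^esub> a) = \<one>\<^bsub>R\<^esub>"
  have "a \<in> K" if K: "maximal_graded_left_ideal G R A K" for K
  proof (rule ccontr)
    assume "a \<notin> K"
    have gr: "graded_left_ideal G R A K" and ne: "K \<noteq> carrier R"
      using K unfolding maximal_graded_left_ideal_def by auto
    note l = graded_left_idealD(1)[OF gr]
    have "adjoin K a = carrier R"
      using K graded_left_ideal_adjoin[OF gr a g] subset_adjoin[OF l aR] self_in_adjoin[OF l aR] \<open>a \<notin> K\<close>
      unfolding maximal_graded_left_ideal_def by blast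
    then have "\<one>\<^bsub>R\<^esub> \<in> adjoin K a" by simp
    then obtain x r where xr: "x \<in> K" "r \<in> carrier R" "\<one>\<^bsub>R\<^esub> = x \<oplus>\<^bsub>R\<^esub> r \<otimes>\<^bsub>R\<^esub> a" unfolding adjoin_def by blast
    then have xR: "x \<in> carrier R" using R.left_ideal_subset[OF l] by blast
    \<comment> \<open>The coefficient \<open>r\<close> in \<open>1 = x + r a\<close> is arbitrary;
      projecting the equation to degree one replaces it by the component for which the hypothesis is
      available, and the component of \<open>x\<close> stays in the graded \<open>K\<close>.\<close>
    define r' where "r' = hcomp (inv\<^bsub>G\<^esub> g) r"
    have r': "r' \<in> A (inv\<^bsub>G\<^esub> g)" "r' \<in> carrier R" unfolding r'_def using xr g hcomp_homog by auto
    have "hcomp \<one>\<^bsub>G\<^esub> (r \<otimes>\<^bsub>R\<^esub> a) = r' \<otimes>\<^bsub>R\<^esub> a"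
      using hcomp_mult_homog[OF xr(2) a g, of "inv\<^bsub>G\<^esub> g"] g unfolding r'_def by simp
    moreover have "hcomp \<one>\<^bsub>G\<^esub> \<one>\<^bsub>R\<^esub> = \<one>\<^bsub>R\<^esub>" using hcomp_of_homog[OF one_homog] by simp
    ultimately have 1: "\<one>\<^bsub>R\<^esub> = hcomp \<one>\<^bsub>G\<^esub> x \<oplus>\<^bsub>R\<^esub> r' \<otimes>\<^bsub>R\<^esub> a"
      using hcomp_add[of x "r \<otimes>\<^bsub>R\<^esub> a" "\<one>\<^bsub>G\<^esub>"] xr xR aR by simp
    have "\<one>\<^bsub>R\<^esub> \<ominus>\<^bsub>R\<^esub> r' \<otimes>\<^bsub>R\<^esub> a = (hcomp \<one>\<^bsub>G\<^esub> x \<oplus>\<^bsub>R\<^esub> r' \<otimes>\<^bsub>R\<^esub> a) \<ominus>\<^bsub>R\<^esub> r' \<otimes>\<^bsub>R\<^esub> a"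
      using 1 by simp
    also have "\<dots> = hcomp \<one>\<^bsub>G\<^esub> x"
      using xR r' aR by (simp add: R.minus_eq R.a_assoc R.r_neg)
    finally have "\<one>\<^bsub>R\<^esub> \<ominus>\<^bsub>R\<^esub> r' \<otimes>\<^bsub>R\<^esub> a \<in> K"
      using graded_left_idealD(2)[OF gr xr(1), of "\<one>\<^bsub>G\<^esub>"] by simp
    moreover obtain c where "c \<in> carrier R" "c \<otimes>\<^bsub>R\<^esub> (\<one>\<^bsub>R\<^esub> \<ominus>\<^bsub>R\<^esub> r' \<otimes>\<^bsub>R\<^esub> a) = \<one>\<^bsub>R\<^esub>" using inv r' by blast
    ultimately have "\<one>\<^bsub>R\<^esub> \<in> K" using R.left_ideal_mult[OF l] by metis
    then show False using R.left_ideal_eq_carrier[OF l] ne by simp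
  qed
  then show "a \<in> jac" unfolding gr_jacobson_radical_def using aR by blast
qed

lemma graded_left_ideal_jac: "graded_left_ideal G R A jac"
  unfolding graded_left_ideal_iff
proof (intro conjI ballI R.left_idealI)
  have gr: "graded_left_ideal G R A K" if "maximal_graded_left_ideal G R A K" for K
    using that unfolding maximal_graded_left_ideal_def by blast
  note l = graded_left_idealD(1)[OF gr]
  have J: "x \<in> jac \<longleftrightarrow> x \<in> carrier R \<and> (\<forall>K. maximal_graded_left_ideal G R A K \<longrightarrow> x \<in> K)" for x
    unfolding gr_jacobson_radical_def by blast
  show "jac \<subseteq> carrier R" using J by blast
  show "\<zero>\<^bsub>R\<^esub> \<in> jac" unfolding J using R.left_ideal_zero[OF l] by simp
  show "x \<oplus>\<^bsub>R\<^esub> y \<in> jac" if "x \<in> jac" "y \<in> jac" for x y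
    using that unfolding J by (simp add: R.left_ideal_add[OF l])
  show "r \<otimes>\<^bsub>R\<^esub> x \<in> jac" if "r \<in> carrier R" "x \<in> jac" for r x
    using that unfolding J by (simp add: R.left_ideal_mult[OF l])
  show "hcomp g x \<in> jac" if "x \<in> jac" "g \<in> carrier G" for x g
    using that unfolding J by (simp add: graded_left_idealD(2)[OF gr])
qed

text \<open>An intersection of left ideals gives no control on the right. Here \<open>s r\<close>
  has the degree inverse to that of \<open>a\<close>, so \<open>1 - (s r) a\<close> is left
  invertible, and \<open>one_minus_swap\<close> moves \<open>s\<close> to the other end, yielding
  \<open>1 - r (a s)\<close>.\<close>

lemma jac_mult_homog:
  assumes a: "a \<in> A g" "g \<in> carrier G" "a \<in> jac" and s: "s \<in> A h" "h \<in> carrier G"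
  shows "a \<otimes>\<^bsub>R\<^esub> s \<in> jac"
proof -
  have aR: "a \<in> carrier R" "s \<in> carrier R" using a s by simp_all
  have "\<exists>c\<in>carrier R. c \<otimes>\<^bsub>R\<^esub> (\<one>\<^bsub>R\<^esub> \<ominus>\<^bsub>R\<^esub> r \<otimes>\<^bsub>R\<^esub> (a \<otimes>\<^bsub>R\<^esub> s)) = \<one>\<^bsub>R\<^esub>" if r: "r \<in> A (inv\<^bsub>G\<^esub> (g \<otimes>\<^bsub>G\<^esub> h))" for r
  proof -
    have rR: "r \<in> carrier R" using r a s by simp
    have "h \<otimes>\<^bsub>G\<^esub> inv\<^bsub>G\<^esub> (g \<otimes>\<^bsub>G\<^esub> h) = inv\<^bsub>G\<^esub> g"
      using a s by (simp add: G.inv_mult_group G.m_assoc[symmetric])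
    then have "s \<otimes>\<^bsub>R\<^esub> r \<in> A (inv\<^bsub>G\<^esub> g)"
      using graded_mult[OF s(2) _ s(1) r] a(2) s(2) by simp
    then obtain c where c: "c \<in> carrier R" "c \<otimes>\<^bsub>R\<^esub> (\<one>\<^bsub>R\<^esub> \<ominus>\<^bsub>R\<^esub> (s \<otimes>\<^bsub>R\<^esub> r) \<otimes>\<^bsub>R\<^esub> a) = \<one>\<^bsub>R\<^esub>"
      using homog_mem_jac_iff[OF a(1,2)] a(3) by blast
    then have "c \<otimes>\<^bsub>R\<^esub> (\<one>\<^bsub>R\<^esub> \<ominus>\<^bsub>R\<^esub> s \<otimes>\<^bsub>R\<^esub> (r \<otimes>\<^bsub>R\<^esub> a)) = \<one>\<^bsub>R\<^esub>" using aR rR by (simp add: R.m_assoc)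
    then have "(\<one>\<^bsub>R\<^esub> \<oplus>\<^bsub>R\<^esub> (r \<otimes>\<^bsub>R\<^esub> a) \<otimes>\<^bsub>R\<^esub> c \<otimes>\<^bsub>R\<^esub> s) \<otimes>\<^bsub>R\<^esub> (\<one>\<^bsub>R\<^esub> \<ominus>\<^bsub>R\<^esub> (r \<otimes>\<^bsub>R\<^esub> a) \<otimes>\<^bsub>R\<^esub> s) = \<one>\<^bsub>R\<^esub>"
      using R.one_minus_swap[of "r \<otimes>\<^bsub>R\<^esub> a" s c] aR rR c(1) by simp
    then have "(\<one>\<^bsub>R\<^esub> \<oplus>\<^bsub>R\<^esub> (r \<otimes>\<^bsub>R\<^esub> a) \<otimes>\<^bsub>R\<^esub> c \<otimes>\<^bsub>R\<^esub> s) \<otimes>\<^bsub>R\<^esub> (\<one>\<^bsub>R\<^esub> \<ominus>\<^bsub>R\<^esub> r \<otimes>\<^bsub>R\<^esub> (a \<otimes>\<^bsub>R\<^esub> s)) = \<one>\<^bsub>R\<^esub>"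
      using aR rR by (simp add: R.m_assoc)
    moreover have "\<one>\<^bsub>R\<^esub> \<oplus>\<^bsub>R\<^esub> (r \<otimes>\<^bsub>R\<^esub> a) \<otimes>\<^bsub>R\<^esub> c \<otimes>\<^bsub>R\<^esub> s \<in> carrier R" using aR rR c(1) by simp
    ultimately show ?thesis by blast
  qed
  then show ?thesis
    using homog_mem_jac_iff[of "a \<otimes>\<^bsub>R\<^esub> s" "g \<otimes>\<^bsub>G\<^esub> h"] graded_mult[of g h a s] a s by simp
qed

text \<open>The homogeneous case extends in two passes: the right factor is split into components
  first, then the left one, whose components remain in the radical because the radical is
  graded.\<close>

lemma ideal_jac: "ideal jac R"
proof -
  note gr = graded_left_ideal_jac
  note l = graded_left_idealD(1)[OF gr]
  have J: "\<And>x. x \<in> jac \<Longrightarrow> x \<in> carrier R" unfolding gr_jacobson_radical_def by blast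
  have 1: "a \<otimes>\<^bsub>R\<^esub> s \<in> jac" if a: "a \<in> A g" "g \<in> carrier G" "a \<in> jac" and s: "s \<in> carrier R" for a s g
  proof -
    have F: "finite (hsupp s)" "hsupp s \<subseteq> carrier G" using s finite_hsupp hsupp_subset by auto
    have "a \<otimes>\<^bsub>R\<^esub> s = a \<otimes>\<^bsub>R\<^esub> finsum R (\<lambda>k. hcomp k s) (hsupp s)"
      using finsum_hcomp[OF s F(1) order_refl F(2)] by simp
    also have "\<dots> = finsum R (\<lambda>k. a \<otimes>\<^bsub>R\<^esub> hcomp k s) (hsupp s)"
      by (rule R.finsum_rdistr) (use F s J a in auto)
    also have "\<dots> \<in> jac"
    proof (rule R.left_ideal_finsum[OF l], rule)
      fix k assume "k \<in> hsupp s"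
      then have k: "k \<in> carrier G" using F(2) by blast
      show "a \<otimes>\<^bsub>R\<^esub> hcomp k s \<in> jac" using jac_mult_homog[OF a hcomp_homog[OF s k] k] .
    qed
    finally show ?thesis .
  qed
  have "x \<otimes>\<^bsub>R\<^esub> s \<in> jac" if x: "x \<in> jac" and s: "s \<in> carrier R" for x s
  proof -
    have xR: "x \<in> carrier R" using J x .
    have F: "finite (hsupp x)" "hsupp x \<subseteq> carrier G" using xR finite_hsupp hsupp_subset by auto
    have "x \<otimes>\<^bsub>R\<^esub> s = finsum R (\<lambda>k. hcomp k x) (hsupp x) \<otimes>\<^bsub>R\<^esub> s"
      using finsum_hcomp[OF xR F(1) order_refl F(2)] by simp
    also have "\<dots> = finsum R (\<lambda>k. hcomp k x \<otimes>\<^bsub>R\<^esub> s) (hsupp x)"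
      by (rule R.finsum_ldistr) (use F s xR in auto)
    also have "\<dots> \<in> jac"
    proof (rule R.left_ideal_finsum[OF l], rule)
      fix k assume "k \<in> hsupp x"
      then have k: "k \<in> carrier G" using F(2) by blast
      show "hcomp k x \<otimes>\<^bsub>R\<^esub> s \<in> jac"
        using 1[OF hcomp_homog[OF xR k] k graded_left_idealD(2)[OF gr x k] s] .
    qed
    finally show ?thesis .
  qed
  then show ?thesis
    using R.left_ideal_mult[OF l] left_ideal.axioms(1)[OF l]
    by (intro idealI R.ring_axioms) (auto simp: additive_subgroup_def)
qed

end

section \<open>Essential left ideals\<close>

context ring
begin

lemma essential_left_ideal_obtain:
  assumes "essential_left_ideal R D" "left_ideal K R" "K \<noteq> {\<zero>}"
  obtains x where "x \<in> D" "x \<in> K" "x \<noteq> \<zero>"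
proof -
  have "D \<inter> K \<noteq> {\<zero>}" using assms unfolding essential_left_ideal_def by blast
  moreover have "\<zero> \<in> D \<inter> K"
    using assms left_ideal_zero unfolding essential_left_ideal_def by blast
  ultimately show ?thesis using that by blast
qed

lemma essential_left_idealI:
  assumes D: "left_ideal D R"
    and mult: "\<And>x. \<lbrakk>x \<in> carrier R; x \<noteq> \<zero>\<rbrakk> \<Longrightarrow> \<exists>s\<in>carrier R. s \<otimes> x \<in> D \<and> s \<otimes> x \<noteq> \<zero>"
  shows "essential_left_ideal R D"
  unfolding essential_left_ideal_def
proof (intro conjI allI impI D)
  fix K assume K: "left_ideal K R \<and> K \<noteq> {\<zero>}"
  then have "\<zero> \<in> K" using left_ideal_zero by blast
  then obtain x where x: "x \<in> K" "x \<noteq> \<zero>" using K by blast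
  then have "x \<in> carrier R" using left_ideal_subset K by blast
  then obtain s where "s \<in> carrier R" "s \<otimes> x \<in> D" "s \<otimes> x \<noteq> \<zero>" using mult x(2) by blast
  then show "D \<inter> K \<noteq> {\<zero>}" using left_ideal_mult[OF _ x(1)] K by blast
qed

lemma essential_left_ideal_mono:
  assumes "essential_left_ideal R D" "D \<subseteq> D'" "left_ideal D' R"
  shows "essential_left_ideal R D'"
  unfolding essential_left_ideal_def
proof (intro conjI allI impI assms(3))
  fix K assume K: "left_ideal K R \<and> K \<noteq> {\<zero>}"
  then obtain x where "x \<in> D" "x \<in> K" "x \<noteq> \<zero>"
    using essential_left_ideal_obtain[OF assms(1)] by blast
  then show "D' \<inter> K \<noteq> {\<zero>}" using assms(2) by blast
qed

end

context graded_ring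
begin

text \<open>A multiple of \<open>x\<close> lying in \<open>D\<close> is found by correcting one component of \<open>x\<close> at a time.\<close>

lemma homog_multiple_in_graded_left_ideal:
  assumes D: "left_ideal D R"
    and homog: "\<And>y g. \<lbrakk>y \<in> A g; g \<in> carrier G; y \<noteq> \<zero>\<^bsub>R\<^esub>\<rbrakk> \<Longrightarrow>
      \<exists>h\<in>carrier G. \<exists>s\<in>A h. s \<otimes>\<^bsub>R\<^esub> y \<in> D \<and> s \<otimes>\<^bsub>R\<^esub> y \<noteq> \<zero>\<^bsub>R\<^esub>"
    and x: "x \<in> carrier R" "x \<noteq> \<zero>\<^bsub>R\<^esub>"
  shows "\<exists>h\<in>carrier G. \<exists>s\<in>A h. s \<otimes>\<^bsub>R\<^esub> x \<in> D \<and> s \<otimes>\<^bsub>R\<^esub> x \<noteq> \<zero>\<^bsub>R\<^esub>"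
  using x
proof (induction "card (hsupp x)" arbitrary: x rule: less_induct)
  case less
  obtain g where g: "g \<in> carrier G" "hcomp g x \<noteq> \<zero>\<^bsub>R\<^esub>"
    using nonzero_hcomp[OF less.prems] .
  define y where "y = hcomp g x"
  have y: "y \<in> A g" "y \<in> carrier R" using less.prems g hcomp_homog unfolding y_def by auto
  obtain h s where s: "h \<in> carrier G" "s \<in> A h" "s \<otimes>\<^bsub>R\<^esub> y \<in> D" "s \<otimes>\<^bsub>R\<^esub> y \<noteq> \<zero>\<^bsub>R\<^esub>"
    using homog[OF y(1) g(1)] g(2) unfolding y_def by blast
  have sR: "s \<in> carrier R" using s by simp
  \<comment> \<open>\<open>w\<close> is \<open>s x\<close> without its component coming from
    \<open>y\<close>. Since \<open>s\<close> is homogeneous, it only translates degrees, so the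
    support of \<open>w\<close> fits into a translate of the support of \<open>x\<close> with
    \<open>g\<close> removed and the induction applies.\<close>
  define w where "w = s \<otimes>\<^bsub>R\<^esub> x \<ominus>\<^bsub>R\<^esub> s \<otimes>\<^bsub>R\<^esub> y"
  have wR: "w \<in> carrier R" unfolding w_def using sR less.prems y by simp
  have sx: "s \<otimes>\<^bsub>R\<^esub> x = w \<oplus>\<^bsub>R\<^esub> s \<otimes>\<^bsub>R\<^esub> y"
    unfolding w_def using sR less.prems y by (simp add: R.minus_eq R.a_assoc R.l_neg)
  have w_comp: "hcomp (h \<otimes>\<^bsub>G\<^esub> k) w = (if k = g then \<zero>\<^bsub>R\<^esub> else s \<otimes>\<^bsub>R\<^esub> hcomp k x)"
    if k: "k \<in> carrier G" for k
  proof -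
    have "hcomp (h \<otimes>\<^bsub>G\<^esub> k) w = hcomp (h \<otimes>\<^bsub>G\<^esub> k) (s \<otimes>\<^bsub>R\<^esub> x) \<ominus>\<^bsub>R\<^esub> hcomp (h \<otimes>\<^bsub>G\<^esub> k) (s \<otimes>\<^bsub>R\<^esub> y)"
      unfolding w_def by (rule hcomp_minus) (use sR less.prems y s k in auto)
    also have "\<dots> = s \<otimes>\<^bsub>R\<^esub> hcomp k x \<ominus>\<^bsub>R\<^esub> s \<otimes>\<^bsub>R\<^esub> hcomp k y"
      using hcomp_homog_mult[OF less.prems(1) s(2,1) k] hcomp_homog_mult[OF y(2) s(2,1) k] by simp
    finally show ?thesis
      using hcomp_of_homog[OF y(1) g(1) k] sR less.prems k y y_def
      by (auto simp: R.minus_eq R.r_neg)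
  qed
  have sx0: "s \<otimes>\<^bsub>R\<^esub> x \<noteq> \<zero>\<^bsub>R\<^esub>"
  proof
    assume "s \<otimes>\<^bsub>R\<^esub> x = \<zero>\<^bsub>R\<^esub>"
    then have "hcomp (h \<otimes>\<^bsub>G\<^esub> g) \<zero>\<^bsub>R\<^esub> = s \<otimes>\<^bsub>R\<^esub> y"
      using hcomp_homog_mult[OF less.prems(1) s(2,1) g(1)] unfolding y_def by simp
    then show False using s(1,4) g(1) by simp
  qed
  show ?case
  proof (cases "w = \<zero>\<^bsub>R\<^esub>")
    case True
    then have "s \<otimes>\<^bsub>R\<^esub> x = s \<otimes>\<^bsub>R\<^esub> y" using sx sR y by simp
    then show ?thesis using s by metis
  next
    case False
    have "hsupp w \<subseteq> (\<lambda>k. h \<otimes>\<^bsub>G\<^esub> k) ` (hsupp x - {g})"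
    proof
      fix l assume "l \<in> hsupp w"
      then have l: "l \<in> carrier G" "hcomp l w \<noteq> \<zero>\<^bsub>R\<^esub>" unfolding hsupp_def by auto
      define k where "k = inv\<^bsub>G\<^esub> h \<otimes>\<^bsub>G\<^esub> l"
      have k: "k \<in> carrier G" "l = h \<otimes>\<^bsub>G\<^esub> k"
        unfolding k_def using s(1) l(1) by (simp_all add: G.m_assoc[symmetric])
      then have "k \<noteq> g" "hcomp k x \<noteq> \<zero>\<^bsub>R\<^esub>"
        using w_comp[OF k(1)] l(2) sR k(2) by (auto split: if_splits)
      then show "l \<in> (\<lambda>k. h \<otimes>\<^bsub>G\<^esub> k) ` (hsupp x - {g})" using k unfolding hsupp_def by blast
    qed
    moreover have fin: "finite (hsupp x)" using finite_hsupp less.prems by blast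
    ultimately have "card (hsupp w) \<le> card (hsupp x - {g})"
      by (metis card_image_le card_mono finite_Diff finite_imageI order_trans)
    also have "\<dots> < card (hsupp x)"
      using fin g by (intro card_Diff1_less) (auto simp: hsupp_def)
    finally obtain l t where t: "l \<in> carrier G" "t \<in> A l" "t \<otimes>\<^bsub>R\<^esub> w \<in> D" "t \<otimes>\<^bsub>R\<^esub> w \<noteq> \<zero>\<^bsub>R\<^esub>"
      using less.hyps[OF _ wR False] by blast
    have tR: "t \<in> carrier R" using t by simp
    have ts: "t \<otimes>\<^bsub>R\<^esub> s \<in> A (l \<otimes>\<^bsub>G\<^esub> h)" "l \<otimes>\<^bsub>G\<^esub> h \<in> carrier G"
      using graded_mult[OF t(1) s(1) t(2) s(2)] t s by auto
    have eq: "(t \<otimes>\<^bsub>R\<^esub> s) \<otimes>\<^bsub>R\<^esub> x = t \<otimes>\<^bsub>R\<^esub> w \<oplus>\<^bsub>R\<^esub> t \<otimes>\<^bsub>R\<^esub> (s \<otimes>\<^bsub>R\<^esub> y)"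
      using sx tR sR wR y less.prems by (simp add: R.m_assoc R.r_distr)
    have "(t \<otimes>\<^bsub>R\<^esub> s) \<otimes>\<^bsub>R\<^esub> x \<in> D"
      unfolding eq using R.left_ideal_add[OF D t(3)] R.left_ideal_mult[OF D s(3) tR] by blast
    \<comment> \<open>No cancellation can occur: \<open>t (s y)\<close> is concentrated in degree
      \<open>l h g\<close>, and \<open>t w\<close> has zero component there. If the sum vanished,
      every component of \<open>t w\<close> would vanish.\<close>
    moreover have "(t \<otimes>\<^bsub>R\<^esub> s) \<otimes>\<^bsub>R\<^esub> x \<noteq> \<zero>\<^bsub>R\<^esub>"
    proof
      assume 0: "(t \<otimes>\<^bsub>R\<^esub> s) \<otimes>\<^bsub>R\<^esub> x = \<zero>\<^bsub>R\<^esub>"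
      have "hcomp k (t \<otimes>\<^bsub>R\<^esub> w) = \<zero>\<^bsub>R\<^esub>" if k: "k \<in> carrier G" for k
      proof (cases "k = l \<otimes>\<^bsub>G\<^esub> (h \<otimes>\<^bsub>G\<^esub> g)")
        case True
        have "hcomp (l \<otimes>\<^bsub>G\<^esub> (h \<otimes>\<^bsub>G\<^esub> g)) (t \<otimes>\<^bsub>R\<^esub> w) = t \<otimes>\<^bsub>R\<^esub> hcomp (h \<otimes>\<^bsub>G\<^esub> g) w"
          using hcomp_homog_mult[OF wR t(2,1)] s(1) g(1) by simp
        then show ?thesis using w_comp[OF g(1)] tR True by simp
      next
        case False
        have "t \<otimes>\<^bsub>R\<^esub> (s \<otimes>\<^bsub>R\<^esub> y) \<in> A (l \<otimes>\<^bsub>G\<^esub> (h \<otimes>\<^bsub>G\<^esub> g))"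
          using graded_mult t s g(1) y(1) by simp
        then have "hcomp k (t \<otimes>\<^bsub>R\<^esub> (s \<otimes>\<^bsub>R\<^esub> y)) = \<zero>\<^bsub>R\<^esub>"
          using hcomp_of_homog[of "t \<otimes>\<^bsub>R\<^esub> (s \<otimes>\<^bsub>R\<^esub> y)" "l \<otimes>\<^bsub>G\<^esub> (h \<otimes>\<^bsub>G\<^esub> g)" k] k False t s g(1) by simp
        moreover have "hcomp k ((t \<otimes>\<^bsub>R\<^esub> s) \<otimes>\<^bsub>R\<^esub> x) = hcomp k (t \<otimes>\<^bsub>R\<^esub> w) \<oplus>\<^bsub>R\<^esub> hcomp k (t \<otimes>\<^bsub>R\<^esub> (s \<otimes>\<^bsub>R\<^esub> y))"
          unfolding eq by (rule hcomp_add) (use tR wR sR y k in auto)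
        ultimately show ?thesis using 0 k tR wR by simp
      qed
      then show False using nonzero_hcomp[OF _ t(4)] tR wR by (metis R.m_closed)
    qed
    ultimately show ?thesis using ts by blast
  qed
qed

text \<open>For a homogeneous \<open>y\<close> outside \<open>K\<close>, maximality forces
  \<open>K + R y\<close> to meet \<open>L\<close> in a nonzero element \<open>v + r y\<close>. A
  nonzero component of it exhibits a multiple of \<open>y\<close> as an element of \<open>L\<close>
  minus an element of \<open>K\<close>, hence in \<open>D\<close>; this multiple is nonzero because
  \<open>K\<close> and \<open>L\<close> meet only in zero.\<close>

lemma complement_essential:
  assumes K: "graded_left_ideal G R A K" and L: "graded_left_ideal G R A L"
    and KL: "K \<inter> (L - {\<zero>\<^bsub>R\<^esub>}) = {}"
    and max: "\<And>K'. \<lbrakk>graded_left_ideal G R A K'; K \<subseteq> K'; K' \<inter> (L - {\<zero>\<^bsub>R\<^esub>}) = {}\<rbrakk> \<Longrightarrow> K' = K"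
    and D: "left_ideal D R" "K \<subseteq> D" "L \<subseteq> D"
  shows "essential_left_ideal R D"
proof (rule R.essential_left_idealI[OF D(1)])
  note k = graded_left_idealD(1)[OF K]
  have "\<exists>h\<in>carrier G. \<exists>s\<in>A h. s \<otimes>\<^bsub>R\<^esub> y \<in> D \<and> s \<otimes>\<^bsub>R\<^esub> y \<noteq> \<zero>\<^bsub>R\<^esub>"
    if y: "y \<in> A g" "g \<in> carrier G" "y \<noteq> \<zero>\<^bsub>R\<^esub>" for y g
  proof (cases "y \<in> K")
    case True
    then have "\<one>\<^bsub>R\<^esub> \<otimes>\<^bsub>R\<^esub> y \<in> D \<and> \<one>\<^bsub>R\<^esub> \<otimes>\<^bsub>R\<^esub> y \<noteq> \<zero>\<^bsub>R\<^esub>" using D(2) y by auto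
    then show ?thesis using one_homog by blast
  next
    case False
    have yR: "y \<in> carrier R" using y by simp
    have gr: "graded_left_ideal G R A (adjoin K y)" using graded_left_ideal_adjoin[OF K y(1,2)] .
    have "adjoin K y \<inter> (L - {\<zero>\<^bsub>R\<^esub>}) \<noteq> {}"
      using max[OF gr subset_adjoin[OF k yR]] self_in_adjoin[OF k yR] False by blast
    then obtain v r where v: "v \<in> K" "r \<in> carrier R" "v \<oplus>\<^bsub>R\<^esub> r \<otimes>\<^bsub>R\<^esub> y \<in> L" "v \<oplus>\<^bsub>R\<^esub> r \<otimes>\<^bsub>R\<^esub> y \<noteq> \<zero>\<^bsub>R\<^esub>"
      unfolding adjoin_def by blast
    have vR: "v \<in> carrier R" using R.left_ideal_subset[OF k] v(1) by blast
    obtain l where l: "l \<in> carrier G" "hcomp l (v \<oplus>\<^bsub>R\<^esub> r \<otimes>\<^bsub>R\<^esub> y) \<noteq> \<zero>\<^bsub>R\<^esub>"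
      using nonzero_hcomp[OF _ v(4)] vR v(2) yR by blast
    \<comment> \<open>With this degree, the component of \<open>r y\<close> in degree
      \<open>l\<close> is the component of \<open>r\<close> in degree \<open>h\<close> times
      \<open>y\<close>, so the scalar becomes homogeneous.\<close>
    define h where "h = l \<otimes>\<^bsub>G\<^esub> inv\<^bsub>G\<^esub> g"
    have h: "h \<in> carrier G" "l = h \<otimes>\<^bsub>G\<^esub> g" unfolding h_def using l(1) y(2) by (simp_all add: G.m_assoc)
    define s where "s = hcomp h r"
    have s: "s \<in> A h" "s \<in> carrier R" unfolding s_def using h v(2) hcomp_homog by auto
    define v' where "v' = hcomp l v"
    have v': "v' \<in> K" "v' \<in> carrier R" unfolding v'_def using graded_left_idealD(2)[OF K v(1) l(1)] vR l(1) by auto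
    have eq: "hcomp l (v \<oplus>\<^bsub>R\<^esub> r \<otimes>\<^bsub>R\<^esub> y) = v' \<oplus>\<^bsub>R\<^esub> s \<otimes>\<^bsub>R\<^esub> y"
      using hcomp_add[OF vR _ l(1), of "r \<otimes>\<^bsub>R\<^esub> y"] hcomp_mult_homog[OF v(2) y(1,2) h(1)] v(2) yR
      unfolding v'_def s_def h(2) by simp
    have L': "v' \<oplus>\<^bsub>R\<^esub> s \<otimes>\<^bsub>R\<^esub> y \<in> L" "v' \<oplus>\<^bsub>R\<^esub> s \<otimes>\<^bsub>R\<^esub> y \<noteq> \<zero>\<^bsub>R\<^esub>"
      using graded_left_idealD(2)[OF L v(3) l(1)] l(2) eq by auto
    have sy: "s \<otimes>\<^bsub>R\<^esub> y = (v' \<oplus>\<^bsub>R\<^esub> s \<otimes>\<^bsub>R\<^esub> y) \<ominus>\<^bsub>R\<^esub> v'"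
      using v'(2) s(2) yR by (simp add: R.minus_eq R.a_ac R.r_neg R.r_neg1 R.r_neg2)
    have "s \<otimes>\<^bsub>R\<^esub> y \<in> D"
      using R.left_ideal_minus[OF D(1), of "v' \<oplus>\<^bsub>R\<^esub> s \<otimes>\<^bsub>R\<^esub> y" v'] L' v'(1) D(2,3) sy by auto
    moreover have "s \<otimes>\<^bsub>R\<^esub> y \<noteq> \<zero>\<^bsub>R\<^esub>"
    proof
      assume "s \<otimes>\<^bsub>R\<^esub> y = \<zero>\<^bsub>R\<^esub>"
      then have "v' \<in> L" "v' \<noteq> \<zero>\<^bsub>R\<^esub>" using L' v'(2) by auto
      then show False using v'(1) KL by blast
    qed
    ultimately show ?thesis using h(1) s(1) by blast
  qed
  \<comment> \<open>Passage from homogeneous elements to all elements, that is, from graded to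
    ordinary essentiality.\<close>
  then show "\<exists>s\<in>carrier R. s \<otimes>\<^bsub>R\<^esub> x \<in> D \<and> s \<otimes>\<^bsub>R\<^esub> x \<noteq> \<zero>\<^bsub>R\<^esub>"
    if "x \<in> carrier R" "x \<noteq> \<zero>\<^bsub>R\<^esub>" for x
    using homog_multiple_in_graded_left_ideal[OF D(1) _ that] homog_closed by metis
qed

end


section \<open>Self-injective graded rings\<close>

text \<open>The only consequence of graded self-injectivity that the proof uses.\<close>

locale gr_self_injective = graded_ring +
  assumes right_mult_invert:
    "\<lbrakk>graded_left_ideal G R A K; a \<in> A g; g \<in> carrier G; K \<inter> left_annihilator R a = {\<zero>\<^bsub>R\<^esub>}\<rbrakk>
      \<Longrightarrow> \<exists>b\<in>A (inv\<^bsub>G\<^esub> g). \<forall>k\<in>K. k \<otimes>\<^bsub>R\<^esub> a \<otimes>\<^bsub>R\<^esub> b = k"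
begin

lemma right_inverse_one_minus:
  assumes x: "x \<in> gr_singular_component R A g" and g: "g \<in> carrier G" and r: "r \<in> A (inv\<^bsub>G\<^esub> g)"
  shows "\<exists>c\<in>A \<one>\<^bsub>G\<^esub>. (\<one>\<^bsub>R\<^esub> \<ominus>\<^bsub>R\<^esub> x \<otimes>\<^bsub>R\<^esub> r) \<otimes>\<^bsub>R\<^esub> c = \<one>\<^bsub>R\<^esub>"
proof -
  have xA: "x \<in> A g" and ess: "essential_left_ideal R (left_annihilator R x)"
    using x unfolding gr_singular_component_def by auto
  have xR: "x \<in> carrier R" "r \<in> carrier R" using xA r g by simp_all
  let ?u = "\<one>\<^bsub>R\<^esub> \<ominus>\<^bsub>R\<^esub> x \<otimes>\<^bsub>R\<^esub> r"
  have u: "?u \<in> A \<one>\<^bsub>G\<^esub>" "?u \<in> carrier R" using one_minus_homog(2)[OF xA r g] xR by auto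
  note ann = R.left_ideal_left_annihilator[OF u(2)]
  \<comment> \<open>Otherwise essentiality supplies a nonzero \<open>t\<close> killing both
    \<open>x\<close> and \<open>1 - x r\<close>; but \<open>t x = 0\<close> gives
    \<open>t (1 - x r) = t\<close>.\<close>
  have "left_annihilator R ?u = {\<zero>\<^bsub>R\<^esub>}"
  proof (rule ccontr)
    assume "left_annihilator R ?u \<noteq> {\<zero>\<^bsub>R\<^esub>}"
    then obtain t where t: "t \<in> left_annihilator R x" "t \<in> left_annihilator R ?u" "t \<noteq> \<zero>\<^bsub>R\<^esub>"
      by (rule R.essential_left_ideal_obtain[OF ess ann])
    then have tR: "t \<in> carrier R" "t \<otimes>\<^bsub>R\<^esub> x = \<zero>\<^bsub>R\<^esub>" "t \<otimes>\<^bsub>R\<^esub> ?u = \<zero>\<^bsub>R\<^esub>" by (auto simp: left_annihilator_def)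
    have "t \<otimes>\<^bsub>R\<^esub> ?u = t \<ominus>\<^bsub>R\<^esub> (t \<otimes>\<^bsub>R\<^esub> x) \<otimes>\<^bsub>R\<^esub> r"
      using tR(1) xR by (simp add: R.minus_eq R.r_distr R.r_minus R.m_assoc)
    also have "\<dots> = t" using tR xR by (simp add: R.minus_eq)
    finally show False using tR(3) t(3) by simp
  qed
  moreover have "graded_left_ideal G R A (carrier R)"
    unfolding graded_left_ideal_iff by (auto intro!: R.left_idealI)
  ultimately obtain c where "c \<in> A (inv\<^bsub>G\<^esub> \<one>\<^bsub>G\<^esub>)" "\<forall>k\<in>carrier R. k \<otimes>\<^bsub>R\<^esub> ?u \<otimes>\<^bsub>R\<^esub> c = k"
    using right_mult_invert[of "carrier R" ?u "\<one>\<^bsub>G\<^esub>"] u(1) by auto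
  then have "c \<in> A \<one>\<^bsub>G\<^esub>" "\<one>\<^bsub>R\<^esub> \<otimes>\<^bsub>R\<^esub> ?u \<otimes>\<^bsub>R\<^esub> c = \<one>\<^bsub>R\<^esub>" by auto
  then show ?thesis using u(2) by auto
qed

lemma singular_component_subset_jac:
  assumes x: "x \<in> gr_singular_component R A g" and g: "g \<in> carrier G"
  shows "x \<in> jac"
proof -
  have xA: "x \<in> A g" using x unfolding gr_singular_component_def by auto
  have "\<exists>d\<in>carrier R. d \<otimes>\<^bsub>R\<^esub> (\<one>\<^bsub>R\<^esub> \<ominus>\<^bsub>R\<^esub> r \<otimes>\<^bsub>R\<^esub> x) = \<one>\<^bsub>R\<^esub>" if r: "r \<in> A (inv\<^bsub>G\<^esub> g)" for r
  proof -
    have xR: "x \<in> carrier R" "r \<in> carrier R" using xA r g by simp_all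
    obtain c where c: "c \<in> A \<one>\<^bsub>G\<^esub>" "(\<one>\<^bsub>R\<^esub> \<ominus>\<^bsub>R\<^esub> x \<otimes>\<^bsub>R\<^esub> r) \<otimes>\<^bsub>R\<^esub> c = \<one>\<^bsub>R\<^esub>"
      using right_inverse_one_minus[OF x g r] by blast
    have cR: "c \<in> carrier R" using c by simp
    \<comment> \<open>\<open>- (r c)\<close> takes the place of \<open>r\<close>: the equation
      \<open>c = 1 + x r c\<close> presents \<open>c\<close> as an element to which the previous
      lemma applies again.\<close>
    have rc: "\<ominus>\<^bsub>R\<^esub> (r \<otimes>\<^bsub>R\<^esub> c) \<in> A (inv\<^bsub>G\<^esub> g)"
    proof (rule additive_subgroup.a_inv_closed[OF homog_subgroup])
      show "r \<otimes>\<^bsub>R\<^esub> c \<in> A (inv\<^bsub>G\<^esub> g)" using graded_mult[of "inv\<^bsub>G\<^esub> g" "\<one>\<^bsub>G\<^esub>" r c] r c g by simp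
    qed (use g in simp)
    have "\<one>\<^bsub>R\<^esub> \<ominus>\<^bsub>R\<^esub> x \<otimes>\<^bsub>R\<^esub> (\<ominus>\<^bsub>R\<^esub> (r \<otimes>\<^bsub>R\<^esub> c)) = (\<one>\<^bsub>R\<^esub> \<ominus>\<^bsub>R\<^esub> x \<otimes>\<^bsub>R\<^esub> r) \<otimes>\<^bsub>R\<^esub> c \<oplus>\<^bsub>R\<^esub> x \<otimes>\<^bsub>R\<^esub> (r \<otimes>\<^bsub>R\<^esub> c)"
      unfolding c(2) using xR cR by (simp add: R.minus_eq R.r_minus)
    also have "\<dots> = c"
      using xR cR by (simp add: R.minus_eq R.l_distr R.l_minus R.m_assoc R.a_assoc R.l_neg)
    finally have "\<one>\<^bsub>R\<^esub> \<ominus>\<^bsub>R\<^esub> x \<otimes>\<^bsub>R\<^esub> (\<ominus>\<^bsub>R\<^esub> (r \<otimes>\<^bsub>R\<^esub> c)) = c" .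
    then obtain d where d: "d \<in> A \<one>\<^bsub>G\<^esub>" "c \<otimes>\<^bsub>R\<^esub> d = \<one>\<^bsub>R\<^esub>"
      using right_inverse_one_minus[OF x g rc] by auto
    have dR: "d \<in> carrier R" using d by simp
    have "\<one>\<^bsub>R\<^esub> \<ominus>\<^bsub>R\<^esub> x \<otimes>\<^bsub>R\<^esub> r = (\<one>\<^bsub>R\<^esub> \<ominus>\<^bsub>R\<^esub> x \<otimes>\<^bsub>R\<^esub> r) \<otimes>\<^bsub>R\<^esub> (c \<otimes>\<^bsub>R\<^esub> d)" using d xR by simp
    also have "\<dots> = (\<one>\<^bsub>R\<^esub> \<ominus>\<^bsub>R\<^esub> x \<otimes>\<^bsub>R\<^esub> r) \<otimes>\<^bsub>R\<^esub> c \<otimes>\<^bsub>R\<^esub> d" using xR cR dR by (simp add: R.m_assoc)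
    also have "\<dots> = d" using c(2) dR by simp
    finally have "c \<otimes>\<^bsub>R\<^esub> (\<one>\<^bsub>R\<^esub> \<ominus>\<^bsub>R\<^esub> x \<otimes>\<^bsub>R\<^esub> r) = \<one>\<^bsub>R\<^esub>" using d(2) by simp
    \<comment> \<open>The inverse found belongs to \<open>1 - x r\<close>, while the criterion for
      the radical asks for \<open>1 - r x\<close>.\<close>
    then have "(\<one>\<^bsub>R\<^esub> \<oplus>\<^bsub>R\<^esub> r \<otimes>\<^bsub>R\<^esub> c \<otimes>\<^bsub>R\<^esub> x) \<otimes>\<^bsub>R\<^esub> (\<one>\<^bsub>R\<^esub> \<ominus>\<^bsub>R\<^esub> r \<otimes>\<^bsub>R\<^esub> x) = \<one>\<^bsub>R\<^esub>"
      using R.one_minus_swap[of r x c] xR cR by simp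
    then show ?thesis using xR cR by (metis R.add.m_closed R.m_closed R.one_closed)
  qed
  then show ?thesis using homog_mem_jac_iff[OF xA g] by blast
qed

text \<open>Used twice: it gives regularity of the quotient once singular elements are known to lie
  in the radical, and it is the starting point for showing that homogeneous elements of the radical
  are singular.\<close>

lemma regular_mod_singular:
  assumes a: "a \<in> A g" and g: "g \<in> carrier G"
  obtains b where "b \<in> A (inv\<^bsub>G\<^esub> g)" "a \<ominus>\<^bsub>R\<^esub> a \<otimes>\<^bsub>R\<^esub> b \<otimes>\<^bsub>R\<^esub> a \<in> gr_singular_component R A g"
proof -
  have aR: "a \<in> carrier R" using a g by simp
  let ?L = "left_annihilator R a"
  have L: "graded_left_ideal G R A ?L" using graded_left_ideal_left_annihilator[OF a g] .
  have "{\<zero>\<^bsub>R\<^esub>} \<inter> (?L - {\<zero>\<^bsub>R\<^esub>}) = {}" by blast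
  then obtain K where K: "graded_left_ideal G R A K" "K \<inter> (?L - {\<zero>\<^bsub>R\<^esub>}) = {}"
    and max: "\<And>K'. \<lbrakk>graded_left_ideal G R A K'; K \<subseteq> K'; K' \<inter> (?L - {\<zero>\<^bsub>R\<^esub>}) = {}\<rbrakk> \<Longrightarrow> K' = K"
    using maximal_avoiding_graded_left_ideal[OF graded_left_ideal_zero, of "?L - {\<zero>\<^bsub>R\<^esub>}"] by metis
  have KR: "\<And>k. k \<in> K \<Longrightarrow> k \<in> carrier R" using R.left_ideal_subset[OF graded_left_idealD(1)[OF K(1)]] by blast
  have "K \<inter> ?L = {\<zero>\<^bsub>R\<^esub>}"
    using K(2) R.left_ideal_zero[OF graded_left_idealD(1)[OF K(1)]]
      R.left_ideal_zero[OF graded_left_idealD(1)[OF L]] by blast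
  then obtain b where b: "b \<in> A (inv\<^bsub>G\<^esub> g)" "\<And>k. k \<in> K \<Longrightarrow> k \<otimes>\<^bsub>R\<^esub> a \<otimes>\<^bsub>R\<^esub> b = k"
    using right_mult_invert[OF K(1) a g] by blast
  have bR: "b \<in> carrier R" using b g by simp
  let ?d = "a \<ominus>\<^bsub>R\<^esub> a \<otimes>\<^bsub>R\<^esub> b \<otimes>\<^bsub>R\<^esub> a"
  have "a \<otimes>\<^bsub>R\<^esub> b \<otimes>\<^bsub>R\<^esub> a \<in> A g"
    using graded_mult[OF _ g graded_mult[OF g _ a b(1)] a] g by simp
  then have d: "?d \<in> A g" "?d \<in> carrier R" using homog_minus[OF a _ g] aR bR by auto
  \<comment> \<open>This form settles both summands of the essential ideal: on \<open>K\<close> the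
    bracket equals \<open>k\<close> and the two terms cancel, and on the annihilator of
    \<open>a\<close> both terms contain the factor \<open>k a = 0\<close>.\<close>
  have kd: "k \<otimes>\<^bsub>R\<^esub> ?d = k \<otimes>\<^bsub>R\<^esub> a \<ominus>\<^bsub>R\<^esub> (k \<otimes>\<^bsub>R\<^esub> a \<otimes>\<^bsub>R\<^esub> b) \<otimes>\<^bsub>R\<^esub> a" if "k \<in> carrier R" for k
    using that aR bR by (simp add: R.minus_eq R.r_distr R.r_minus R.m_assoc)
  have "K \<subseteq> left_annihilator R ?d"
  proof
    fix k assume k: "k \<in> K"
    then have "k \<otimes>\<^bsub>R\<^esub> ?d = \<zero>\<^bsub>R\<^esub>" using kd[OF KR[OF k]] b(2)[OF k] KR aR by (simp add: R.minus_eq R.r_neg)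
    then show "k \<in> left_annihilator R ?d" using KR[OF k] by (simp add: left_annihilator_def)
  qed
  moreover have "?L \<subseteq> left_annihilator R ?d"
    using kd aR bR by (auto simp: left_annihilator_def R.minus_eq)
  ultimately have "essential_left_ideal R (left_annihilator R ?d)"
    using complement_essential[OF K(1) L K(2) max] R.left_ideal_left_annihilator[OF d(2)] by blast
  then show ?thesis using that[OF b(1)] d(1) unfolding gr_singular_component_def by blast
qed

lemma homog_jac_singular:
  assumes a: "a \<in> A g" "a \<in> jac" and g: "g \<in> carrier G"
  shows "a \<in> gr_singular_component R A g"
proof -
  have aR: "a \<in> carrier R" using a g by simp
  obtain b where b: "b \<in> A (inv\<^bsub>G\<^esub> g)" and sing: "a \<ominus>\<^bsub>R\<^esub> a \<otimes>\<^bsub>R\<^esub> b \<otimes>\<^bsub>R\<^esub> a \<in> gr_singular_component R A g"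
    using regular_mod_singular[OF a(1) g] .
  have bR: "b \<in> carrier R" using b g by simp
  let ?u = "\<one>\<^bsub>R\<^esub> \<ominus>\<^bsub>R\<^esub> b \<otimes>\<^bsub>R\<^esub> a"
  have u: "?u \<in> A \<one>\<^bsub>G\<^esub>" "?u \<in> carrier R" using one_minus_homog(1)[OF a(1) b g] aR bR by auto
  note unit = homog_mem_jac_iff[OF a(1) g, THEN iffD1, OF a(2), rule_format]
  obtain c0 where c0: "c0 \<in> carrier R" "c0 \<otimes>\<^bsub>R\<^esub> ?u = \<one>\<^bsub>R\<^esub>" using unit[OF b] by blast
  \<comment> \<open>The criterion gives a left inverse of unknown degrees. Its degree-one component
    is still a left inverse, and it makes \<open>c b\<close> homogeneous of the degree needed to
    apply the criterion a second time.\<close>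
  define c where "c = hcomp \<one>\<^bsub>G\<^esub> c0"
  have c: "c \<in> A \<one>\<^bsub>G\<^esub>" "c \<in> carrier R" unfolding c_def using c0 hcomp_homog by auto
  have cu: "c \<otimes>\<^bsub>R\<^esub> ?u = \<one>\<^bsub>R\<^esub>"
    using hcomp_mult_homog[OF c0(1) u(1), of "\<one>\<^bsub>G\<^esub>"] hcomp_of_homog[OF one_homog] c0(2)
    unfolding c_def by simp
  \<comment> \<open>From \<open>c (1 - b a) = 1\<close> follows \<open>c = 1 + c b a\<close>, so the
    criterion with \<open>- (c b)\<close> for \<open>r\<close> gives \<open>c\<close> a left inverse
    too.\<close>
  have cb: "\<ominus>\<^bsub>R\<^esub> (c \<otimes>\<^bsub>R\<^esub> b) \<in> A (inv\<^bsub>G\<^esub> g)"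
  proof (rule additive_subgroup.a_inv_closed[OF homog_subgroup])
    show "c \<otimes>\<^bsub>R\<^esub> b \<in> A (inv\<^bsub>G\<^esub> g)" using graded_mult[of "\<one>\<^bsub>G\<^esub>" "inv\<^bsub>G\<^esub> g" c b] b c g by simp
  qed (use g in simp)
  have "\<one>\<^bsub>R\<^esub> \<ominus>\<^bsub>R\<^esub> (\<ominus>\<^bsub>R\<^esub> (c \<otimes>\<^bsub>R\<^esub> b)) \<otimes>\<^bsub>R\<^esub> a = c \<otimes>\<^bsub>R\<^esub> ?u \<oplus>\<^bsub>R\<^esub> c \<otimes>\<^bsub>R\<^esub> b \<otimes>\<^bsub>R\<^esub> a"
    unfolding cu using aR bR c by (simp add: R.minus_eq R.l_minus)
  also have "\<dots> = c"
    using aR bR c by (simp add: R.minus_eq R.r_distr R.r_minus R.m_assoc R.a_assoc R.l_neg)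
  finally obtain d where d: "d \<in> carrier R" "d \<otimes>\<^bsub>R\<^esub> c = \<one>\<^bsub>R\<^esub>" using unit[OF cb] by auto
  have "d = d \<otimes>\<^bsub>R\<^esub> (c \<otimes>\<^bsub>R\<^esub> ?u)" using cu d by simp
  also have "\<dots> = d \<otimes>\<^bsub>R\<^esub> c \<otimes>\<^bsub>R\<^esub> ?u" using c(2) d(1) u(2) by (simp only: R.m_assoc)
  finally have uc: "?u \<otimes>\<^bsub>R\<^esub> c = \<one>\<^bsub>R\<^esub>" using d u by simp
  \<comment> \<open>Since \<open>1 - b a\<close> is a unit, \<open>a\<close> and
    \<open>a (1 - b a)\<close> have the same left annihilator; the inclusion shown next transfers
    essentiality to that of \<open>a\<close>.\<close>
  have au: "a \<ominus>\<^bsub>R\<^esub> a \<otimes>\<^bsub>R\<^esub> b \<otimes>\<^bsub>R\<^esub> a = a \<otimes>\<^bsub>R\<^esub> ?u"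
    using aR bR by (simp add: R.minus_eq R.r_distr R.r_minus R.m_assoc)
  have "left_annihilator R (a \<ominus>\<^bsub>R\<^esub> a \<otimes>\<^bsub>R\<^esub> b \<otimes>\<^bsub>R\<^esub> a) \<subseteq> left_annihilator R a"
  proof
    fix t assume "t \<in> left_annihilator R (a \<ominus>\<^bsub>R\<^esub> a \<otimes>\<^bsub>R\<^esub> b \<otimes>\<^bsub>R\<^esub> a)"
    then have t: "t \<in> carrier R" "t \<otimes>\<^bsub>R\<^esub> (a \<otimes>\<^bsub>R\<^esub> ?u) = \<zero>\<^bsub>R\<^esub>" unfolding au by (auto simp: left_annihilator_def)
    have "t \<otimes>\<^bsub>R\<^esub> a = t \<otimes>\<^bsub>R\<^esub> (a \<otimes>\<^bsub>R\<^esub> (?u \<otimes>\<^bsub>R\<^esub> c))" using uc aR by simp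
    also have "\<dots> = t \<otimes>\<^bsub>R\<^esub> (a \<otimes>\<^bsub>R\<^esub> ?u) \<otimes>\<^bsub>R\<^esub> c" using t(1) aR u c by (simp add: R.m_assoc)
    finally show "t \<in> left_annihilator R a" using t c by (simp add: left_annihilator_def)
  qed
  then show ?thesis
    using sing R.essential_left_ideal_mono R.left_ideal_left_annihilator[OF aR] a(1)
    unfolding gr_singular_component_def by blast
qed

lemma gr_left_singular_ideal_eq_jac: "gr_left_singular_ideal G R A = jac"
proof (intro equalityI subsetI)
  fix x assume "x \<in> gr_left_singular_ideal G R A"
  then obtain F z where F: "F \<subseteq> carrier G" "z \<in> (\<Pi> g\<in>F. gr_singular_component R A g)"
    "x = finsum R z F"
    unfolding gr_left_singular_ideal_def by blast
  then have "z \<in> F \<rightarrow> jac" using singular_component_subset_jac by blast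
  then show "x \<in> jac"
    using R.left_ideal_finsum graded_left_idealD(1)[OF graded_left_ideal_jac] F(3) by blast
next
  fix x assume x: "x \<in> jac"
  then have xR: "x \<in> carrier R" unfolding gr_jacobson_radical_def by blast
  have "hcomp g x \<in> gr_singular_component R A g" if "g \<in> hsupp x" for g
  proof -
    have g: "g \<in> carrier G" using that hsupp_subset by blast
    show ?thesis
      using homog_jac_singular[OF hcomp_homog[OF xR g] graded_left_idealD(2)[OF graded_left_ideal_jac x g] g] .
  qed
  then show "x \<in> gr_left_singular_ideal G R A"
    using finsum_hcomp[OF xR finite_hsupp[OF xR] order_refl hsupp_subset] finite_hsupp[OF xR] hsupp_subset
    unfolding gr_left_singular_ideal_def by (auto intro!: exI[of _ "hsupp x"] exI[of _ "\<lambda>g. hcomp g x"])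
qed

end

section \<open>Additive images of graded objects\<close>

text \<open>Additivity is asked only on the subgroup \<open>K\<close>, so the lemma serves both the
  map onto the copy of a left ideal and the projection onto a quotient ring.\<close>

lemma finsum_additive_image:
  assumes "abelian_group M" "abelian_group N"
    and f: "f \<in> K \<rightarrow> carrier N" "f \<zero>\<^bsub>M\<^esub> = \<zero>\<^bsub>N\<^esub>"
      "\<And>x y. \<lbrakk>x \<in> K; y \<in> K\<rbrakk> \<Longrightarrow> f (x \<oplus>\<^bsub>M\<^esub> y) = f x \<oplus>\<^bsub>N\<^esub> f y"
    and K: "additive_subgroup K M"
    and z: "z \<in> F \<rightarrow> K"
  shows "finsum M z F \<in> K \<and> f (finsum M z F) = finsum N (\<lambda>i. f (z i)) F"
  using z
proof (induction F rule: infinite_finite_induct)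
  interpret M: abelian_group M by fact
  interpret N: abelian_group N by fact
  interpret K: additive_subgroup K M by fact
  {
    case (infinite F)
    then show ?case using f(2) by simp
  next
    case empty
    then show ?case using f(2) by simp
  next
    case (insert i F)
    moreover have "z \<in> F \<rightarrow> carrier M" "z i \<in> carrier M"
      using insert.prems K.a_subset by auto
    moreover have "(\<lambda>i. f (z i)) \<in> F \<rightarrow> carrier N" "f (z i) \<in> carrier N"
      using insert.prems f(1) by auto
    ultimately show ?case using f(3) by simp
  }
qed

text \<open>Injectivity is only available for test modules whose carriers lie in the type \<open>'m\<close>,
  hence the copy of \<open>K\<close> along an injection \<open>\<phi>\<close>.\<close>

definition transport_module :: "('r \<Rightarrow> 'm) \<Rightarrow> ('r, 's) ring_scheme \<Rightarrow> 'r set \<Rightarrow> ('r, 'm) module" where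
  "transport_module \<phi> R K =
    \<lparr>carrier = \<phi> ` K, mult = undefined, one = undefined, zero = \<phi> \<zero>\<^bsub>R\<^esub>,
     add = (\<lambda>x y. \<phi> (the_inv_into K \<phi> x \<oplus>\<^bsub>R\<^esub> the_inv_into K \<phi> y)),
     smult = (\<lambda>r x. \<phi> (r \<otimes>\<^bsub>R\<^esub> the_inv_into K \<phi> x))\<rparr>"

lemma (in ring) transport_module_simps:
  assumes "inj_on \<phi> K"
  shows "carrier (transport_module \<phi> R K) = \<phi> ` K"
    and "\<zero>\<^bsub>transport_module \<phi> R K\<^esub> = \<phi> \<zero>"
    and "\<lbrakk>x \<in> K; y \<in> K\<rbrakk> \<Longrightarrow> \<phi> x \<oplus>\<^bsub>transport_module \<phi> R K\<^esub> \<phi> y = \<phi> (x \<oplus> y)"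
    and "x \<in> K \<Longrightarrow> r \<odot>\<^bsub>transport_module \<phi> R K\<^esub> \<phi> x = \<phi> (r \<otimes> x)"
  using assms by (simp_all add: transport_module_def the_inv_into_f_f)

lemma (in ring) left_module_transport:
  assumes K: "left_ideal K R" and inj: "inj_on \<phi> K"
  shows "left_module R (transport_module \<phi> R K)"
proof -
  note simps = transport_module_simps[OF inj]
  note cl = left_ideal_add[OF K] left_ideal_mult[OF K] left_ideal_zero[OF K]
  have KR: "\<And>x. x \<in> K \<Longrightarrow> x \<in> carrier R" using left_ideal_subset[OF K] by blast
  have "abelian_group (transport_module \<phi> R K)"
  proof (rule abelian_groupI)
    fix X assume "X \<in> carrier (transport_module \<phi> R K)"
    then obtain x where x: "x \<in> K" "X = \<phi> x" unfolding simps by blast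
    have "\<ominus> x \<in> K" using left_ideal_minus[OF K cl(3) x(1)] KR[OF x(1)] by (simp add: minus_eq)
    then show "\<exists>Y\<in>carrier (transport_module \<phi> R K). Y \<oplus>\<^bsub>transport_module \<phi> R K\<^esub> X = \<zero>\<^bsub>transport_module \<phi> R K\<^esub>"
      unfolding simps x(2) using x(1) KR[OF x(1)] simps(3)[of "\<ominus> x" x] l_neg[of x]
      by (intro bexI[of _ "\<phi> (\<ominus> x)"]) auto
  qed (auto simp: simps cl KR a_assoc intro!: arg_cong[of _ _ \<phi>] a_comm)
  then show ?thesis
    by (intro left_module.intro ring_axioms left_module_axioms.intro)
      (auto simp: simps cl KR l_distr r_distr m_assoc)
qed

section \<open>Shifted copies of graded left ideals, and the use of graded injectivity\<close>

context graded_ring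
begin

text \<open>This is the usual shift of a graded module. Degrees are translated on the right while
  scalars act on the left, so associativity in the group keeps the action graded. Taking
  \<open>g\<close> to be the unit gives the unshifted copy.\<close>

lemma graded_left_module_transport:
  assumes K: "graded_left_ideal G R A K" and inj: "inj_on \<phi> K" and g: "g \<in> carrier G"
  shows "graded_left_module G R A (transport_module \<phi> R K) (\<lambda>h. \<phi> ` (K \<inter> A (h \<otimes>\<^bsub>G\<^esub> g)))"
proof -
  let ?M = "transport_module \<phi> R K" and ?B = "\<lambda>h. \<phi> ` (K \<inter> A (h \<otimes>\<^bsub>G\<^esub> g))"
  note l = graded_left_idealD(1)[OF K]
  note simps = R.transport_module_simps[OF inj]
  have KR: "\<And>x. x \<in> K \<Longrightarrow> x \<in> carrier R" using R.left_ideal_subset[OF l] by blast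
  have zero: "\<zero>\<^bsub>R\<^esub> \<in> K" using R.left_ideal_zero[OF l] .
  interpret M: left_module R ?M by (rule R.left_module_transport[OF l inj])
  have ab: "abelian_group ?M" ..
  have sumM: "finsum R z F \<in> K \<and> \<phi> (finsum R z F) = finsum ?M (\<lambda>i. \<phi> (z i)) F"
    if "z \<in> F \<rightarrow> K" for z and F :: "'g set"
    by (rule finsum_additive_image[OF R.abelian_group_axioms ab])
      (use simps left_ideal.axioms(1)[OF l] that in auto)
  have "internal_direct_sum ?M (carrier G) ?B"
  proof (rule abelian_group.internal_direct_sumI[OF ab])
    fix h assume h: "h \<in> carrier G"
    then have hg: "h \<otimes>\<^bsub>G\<^esub> g \<in> carrier G" using g by simp
    show "additive_subgroup (?B h) ?M"
    proof (rule additive_subgroupI, rule group.subgroupI[OF abelian_group.a_group[OF ab]])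
      show "?B h \<subseteq> carrier (add_monoid ?M)" by (auto simp: simps)
      show "?B h \<noteq> {}" using zero homog_zero[OF hg] by blast
      fix X assume "X \<in> ?B h"
      then obtain x where x: "x \<in> K" "x \<in> A (h \<otimes>\<^bsub>G\<^esub> g)" "X = \<phi> x" by blast
      have nx: "\<ominus>\<^bsub>R\<^esub> x \<in> K" "\<ominus>\<^bsub>R\<^esub> x \<in> A (h \<otimes>\<^bsub>G\<^esub> g)"
        using additive_subgroup.a_inv_closed[OF left_ideal.axioms(1)[OF l] x(1)]
          additive_subgroup.a_inv_closed[OF homog_subgroup[OF hg] x(2)] by auto
      have "\<ominus>\<^bsub>?M\<^esub> X = \<phi> (\<ominus>\<^bsub>R\<^esub> x)"
        by (rule M.M.minus_equality) (use x nx KR in \<open>simp_all add: simps R.l_neg\<close>)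
      then show "inv\<^bsub>add_monoid ?M\<^esub> X \<in> ?B h" using nx by (simp add: a_inv_def)
      fix Y assume "Y \<in> ?B h"
      then obtain y where y: "y \<in> K" "y \<in> A (h \<otimes>\<^bsub>G\<^esub> g)" "Y = \<phi> y" by blast
      show "X \<otimes>\<^bsub>add_monoid ?M\<^esub> Y \<in> ?B h"
        using x y simps(3)[OF x(1) y(1)] R.left_ideal_add[OF l] homog_add hg by auto
    qed
  next
    fix X assume "X \<in> carrier ?M"
    then obtain x where x: "x \<in> K" "X = \<phi> x" unfolding simps by blast
    then have xR: "x \<in> carrier R" using KR by blast
    \<comment> \<open>A component of degree \<open>k\<close> in the ring has degree \<open>k\<close>
      times the inverse of \<open>g\<close> in the shifted copy.\<close>
    let ?F = "(\<lambda>k. k \<otimes>\<^bsub>G\<^esub> inv\<^bsub>G\<^esub> g) ` hsupp x"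
    have S: "finite (hsupp x)" "hsupp x \<subseteq> carrier G" using finite_hsupp[OF xR] hsupp_subset by auto
    have F: "finite ?F" "?F \<subseteq> carrier G" using S g by auto
    have w: "hcomp (h \<otimes>\<^bsub>G\<^esub> g) x \<in> K \<inter> A (h \<otimes>\<^bsub>G\<^esub> g)" if "h \<in> ?F" for h
      using that F(2) g graded_left_idealD(2)[OF K x(1)] hcomp_homog[OF xR] by auto
    have "x = finsum R (\<lambda>k. hcomp k x) (hsupp x)"
      using finsum_hcomp[OF xR S(1) order_refl S(2)] by simp
    also have "\<dots> = finsum R (\<lambda>k. hcomp (k \<otimes>\<^bsub>G\<^esub> inv\<^bsub>G\<^esub> g \<otimes>\<^bsub>G\<^esub> g) x) (hsupp x)"
      by (rule R.add.finprod_cong') (use S(2) g xR in \<open>auto simp: G.m_assoc subset_iff\<close>)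
    also have "\<dots> = finsum R (\<lambda>h. hcomp (h \<otimes>\<^bsub>G\<^esub> g) x) ?F"
      by (rule R.finsum_reindex[symmetric])
        (use w KR g S(2) in \<open>auto simp: subset_iff intro!: inj_onI\<close>)
    finally have "X = finsum ?M (\<lambda>h. \<phi> (hcomp (h \<otimes>\<^bsub>G\<^esub> g) x)) ?F"
      using x(2) sumM[of "\<lambda>h. hcomp (h \<otimes>\<^bsub>G\<^esub> g) x" ?F] w by auto
    moreover have "(\<lambda>h. \<phi> (hcomp (h \<otimes>\<^bsub>G\<^esub> g) x)) \<in> Pi ?F ?B" using w by blast
    ultimately show "\<exists>F z. finite F \<and> F \<subseteq> carrier G \<and> z \<in> Pi F ?B \<and> X = finsum ?M z F"
      using F by blast
  next
    fix F z i assume F: "finite F" "F \<subseteq> carrier G" and z: "z \<in> Pi F ?B"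
      and 0: "finsum ?M z F = \<zero>\<^bsub>?M\<^esub>" and i: "i \<in> F"
    have "\<forall>h\<in>F. \<exists>u. u \<in> K \<inter> A (h \<otimes>\<^bsub>G\<^esub> g) \<and> z h = \<phi> u" using z by blast
    then obtain w where w: "\<And>h. h \<in> F \<Longrightarrow> w h \<in> K \<inter> A (h \<otimes>\<^bsub>G\<^esub> g) \<and> z h = \<phi> (w h)" by metis
    have "finsum ?M z F = finsum ?M (\<lambda>h. \<phi> (w h)) F"
      by (rule M.M.add.finprod_cong') (use w in \<open>auto simp: simps\<close>)
    moreover have wK: "finsum R w F \<in> K \<and> \<phi> (finsum R w F) = finsum ?M (\<lambda>h. \<phi> (w h)) F"
      by (rule sumM) (use w in blast)
    ultimately have "\<phi> (finsum R w F) = \<phi> \<zero>\<^bsub>R\<^esub>" using 0 by (simp add: simps)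
    then have sum0: "finsum R w F = \<zero>\<^bsub>R\<^esub>" using inj_onD[OF inj] wK zero by blast
    \<comment> \<open>Relabelled by their degrees in the ring, the preimages \<open>w h\<close> are
      the homogeneous components of a zero sum, so each of them vanishes.\<close>
    let ?F = "(\<lambda>k. k \<otimes>\<^bsub>G\<^esub> g) ` F"
    have sub: "?F \<subseteq> carrier G" using F(2) g by auto
    have P: "(\<lambda>k. w (k \<otimes>\<^bsub>G\<^esub> inv\<^bsub>G\<^esub> g)) \<in> Pi ?F A"
    proof
      fix k assume "k \<in> ?F"
      then obtain h where h: "h \<in> F" "k = h \<otimes>\<^bsub>G\<^esub> g" by blast
      then have "k \<otimes>\<^bsub>G\<^esub> inv\<^bsub>G\<^esub> g = h" using F(2) g by (auto simp: G.m_assoc)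
      then show "w (k \<otimes>\<^bsub>G\<^esub> inv\<^bsub>G\<^esub> g) \<in> A k" using w[OF h(1)] h(2) by simp
    qed
    have "finsum R w F = finsum R (\<lambda>h. w (h \<otimes>\<^bsub>G\<^esub> g \<otimes>\<^bsub>G\<^esub> inv\<^bsub>G\<^esub> g)) F"
      by (rule R.add.finprod_cong') (use w KR F(2) g in \<open>auto simp: G.m_assoc subset_iff\<close>)
    also have "\<dots> = finsum R (\<lambda>k. w (k \<otimes>\<^bsub>G\<^esub> inv\<^bsub>G\<^esub> g)) ?F"
      by (rule R.finsum_reindex[symmetric])
        (use w KR F(2) g in \<open>auto simp: G.m_assoc subset_iff intro!: inj_onI\<close>)
    finally have "hcomp (i \<otimes>\<^bsub>G\<^esub> g) (finsum R w F) = w (i \<otimes>\<^bsub>G\<^esub> g \<otimes>\<^bsub>G\<^esub> inv\<^bsub>G\<^esub> g)"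
      using hcomp_finsum[OF finite_imageI[OF F(1)] sub P, of "i \<otimes>\<^bsub>G\<^esub> g"] F(2) g i by auto
    then have "w i = \<zero>\<^bsub>R\<^esub>" using sum0 i F(2) g by (auto simp: G.m_assoc subset_iff)
    then show "z i = \<zero>\<^bsub>?M\<^esub>" using w[OF i] by (simp add: simps)
  qed
  moreover have "r \<odot>\<^bsub>?M\<^esub> X \<in> ?B (k \<otimes>\<^bsub>G\<^esub> h)"
    if krX: "k \<in> carrier G" "h \<in> carrier G" "r \<in> A k" "X \<in> ?B h" for k h r X
  proof -
    obtain x where x: "x \<in> K" "x \<in> A (h \<otimes>\<^bsub>G\<^esub> g)" "X = \<phi> x" using krX(4) by blast
    have "r \<otimes>\<^bsub>R\<^esub> x \<in> K" using R.left_ideal_mult[OF l x(1)] krX(1,3) by simp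
    moreover have "r \<otimes>\<^bsub>R\<^esub> x \<in> A (k \<otimes>\<^bsub>G\<^esub> h \<otimes>\<^bsub>G\<^esub> g)"
      using graded_mult[OF krX(1) _ krX(3) x(2)] krX(1,2) g by (simp add: G.m_assoc)
    ultimately show ?thesis using x simps(4) by simp
  qed
  ultimately show ?thesis
    by (intro graded_left_module.intro graded_ring_axioms M.left_module_axioms
        graded_left_module_axioms.intro)
qed

text \<open>The extension problem has source \<open>K\<close> with its own grading, middle term
  \<open>R\<close> shifted by \<open>g\<close>, and target \<open>R\<close>. The shift is what makes
  right multiplication by \<open>a\<close> preserve degrees, and the trivial intersection with the
  annihilator is what makes it injective.\<close>

lemma gr_self_injectiveI:
  assumes "carrier R \<lesssim> (UNIV :: 'm set)" and "gr_left_injective TYPE('m) G R A"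
  shows "gr_self_injective G R A"
proof (intro gr_self_injective.intro graded_ring_axioms gr_self_injective_axioms.intro)
  fix K a g
  assume K: "graded_left_ideal G R A K" and a: "a \<in> A g" and g: "g \<in> carrier G"
    and ann: "K \<inter> left_annihilator R a = {\<zero>\<^bsub>R\<^esub>}"
  note l = graded_left_idealD(1)[OF K]
  have aR: "a \<in> carrier R" using a g by simp
  have KR: "\<And>x. x \<in> K \<Longrightarrow> x \<in> carrier R" using R.left_ideal_subset[OF l] by blast
  obtain \<phi> :: "'r \<Rightarrow> 'm" where \<phi>: "inj_on \<phi> (carrier R)"
    using assms(1) unfolding lepoll_def by blast
  then have \<phi>K: "inj_on \<phi> K" using KR by (auto intro: inj_on_subset)
  have R: "graded_left_ideal G R A (carrier R)"
    unfolding graded_left_ideal_iff by (auto intro!: R.left_idealI)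
  let ?\<psi> = "the_inv_into (carrier R) \<phi>"
  have \<psi>: "?\<psi> (\<phi> x) = x" if "x \<in> carrier R" for x using that \<phi> by (simp add: the_inv_into_f_f)
  let ?M = "transport_module \<phi> R K" and ?B = "\<lambda>h. \<phi> ` (K \<inter> A (h \<otimes>\<^bsub>G\<^esub> \<one>\<^bsub>G\<^esub>))"
  let ?N = "transport_module \<phi> R (carrier R)" and ?C = "\<lambda>h. \<phi> ` (carrier R \<inter> A (h \<otimes>\<^bsub>G\<^esub> g))"
  note simpsM = R.transport_module_simps[OF \<phi>K] and simpsN = R.transport_module_simps[OF \<phi>]
  let ?i = "\<lambda>x. \<phi> (?\<psi> x \<otimes>\<^bsub>R\<^esub> a)"
  have M: "graded_left_module G R A ?M ?B" by (rule graded_left_module_transport[OF K \<phi>K]) simp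
  have N: "graded_left_module G R A ?N ?C" by (rule graded_left_module_transport[OF R \<phi> g])
  have i: "?i \<in> gr_hom G R ?M ?B ?N ?C"
    unfolding gr_hom_def
    using aR a g graded_mult
    by (auto simp: simpsM simpsN \<psi> KR R.left_ideal_add[OF l] R.left_ideal_mult[OF l] R.l_distr R.m_assoc)
  \<comment> \<open>The map to be extended is the inclusion of \<open>K\<close> into the ring,
    written as the inverse of \<open>\<phi>\<close> on the copy of \<open>K\<close>.\<close>
  have f: "?\<psi> \<in> gr_hom G R ?M ?B (regular_module R) A"
    unfolding gr_hom_def
    by (auto simp: simpsM \<psi> KR R.left_ideal_add[OF l] R.left_ideal_mult[OF l] regular_module_def)
  have inj: "inj_on ?i (carrier ?M)"
  proof (rule inj_onI)
    fix X Y assume "X \<in> carrier ?M" "Y \<in> carrier ?M" and eq: "?i X = ?i Y"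
    then obtain x y where xy: "x \<in> K" "X = \<phi> x" "y \<in> K" "Y = \<phi> y" unfolding simpsM by blast
    then have "\<phi> (x \<otimes>\<^bsub>R\<^esub> a) = \<phi> (y \<otimes>\<^bsub>R\<^esub> a)" using eq \<psi> KR by simp
    then have "x \<otimes>\<^bsub>R\<^esub> a = y \<otimes>\<^bsub>R\<^esub> a" using inj_onD[OF \<phi>] xy KR aR by simp
    then have "(x \<ominus>\<^bsub>R\<^esub> y) \<otimes>\<^bsub>R\<^esub> a = \<zero>\<^bsub>R\<^esub>"
      using xy KR aR by (simp add: R.minus_eq R.l_distr R.l_minus R.r_neg)
    then have "x \<ominus>\<^bsub>R\<^esub> y \<in> K \<inter> left_annihilator R a"
      using R.left_ideal_minus[OF l xy(1,3)] KR by (simp add: left_annihilator_def)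
    then have "x \<ominus>\<^bsub>R\<^esub> y = \<zero>\<^bsub>R\<^esub>" using ann by blast
    moreover have "x = (x \<ominus>\<^bsub>R\<^esub> y) \<oplus>\<^bsub>R\<^esub> y" using xy KR by (simp add: R.minus_eq R.a_assoc R.l_neg)
    ultimately show "X = Y" using xy KR by simp
  qed
  obtain h where h: "h \<in> gr_hom G R ?N ?C (regular_module R) A" "\<forall>x\<in>carrier ?M. h (?i x) = ?\<psi> x"
    using assms(2) M N i f inj unfolding gr_left_injective_def gr_injective_module_def by blast
  \<comment> \<open>By linearity the extension is right multiplication by its value at the unit,
    which is the wanted \<open>b\<close>.\<close>
  have hR: "h (\<phi> r) = r \<otimes>\<^bsub>R\<^esub> h (\<phi> \<one>\<^bsub>R\<^esub>)" if "r \<in> carrier R" for r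
  proof -
    have "\<phi> \<one>\<^bsub>R\<^esub> \<in> carrier ?N" by (simp add: simpsN)
    then have "h (r \<odot>\<^bsub>?N\<^esub> \<phi> \<one>\<^bsub>R\<^esub>) = r \<odot>\<^bsub>regular_module R\<^esub> h (\<phi> \<one>\<^bsub>R\<^esub>)"
      using h(1) that unfolding gr_hom_def by blast
    then show ?thesis using that by (simp add: simpsN regular_module_def)
  qed
  \<comment> \<open>In the shifted copy the unit of the ring sits in degree inverse to
    \<open>g\<close>; this determines the degree of \<open>b\<close>.\<close>
  have "\<phi> \<one>\<^bsub>R\<^esub> \<in> ?C (inv\<^bsub>G\<^esub> g)" using one_homog g by simp
  then have b: "h (\<phi> \<one>\<^bsub>R\<^esub>) \<in> A (inv\<^bsub>G\<^esub> g)"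
    using h(1) g unfolding gr_hom_def by blast
  have "k \<otimes>\<^bsub>R\<^esub> a \<otimes>\<^bsub>R\<^esub> h (\<phi> \<one>\<^bsub>R\<^esub>) = k" if k: "k \<in> K" for k
  proof -
    have "h (?i (\<phi> k)) = ?\<psi> (\<phi> k)" using h(2) k by (simp add: simpsM)
    then show ?thesis using hR[of "k \<otimes>\<^bsub>R\<^esub> a"] KR[OF k] aR \<psi> by simp
  qed
  with b show "\<exists>b\<in>A (inv\<^bsub>G\<^esub> g). \<forall>k\<in>K. k \<otimes>\<^bsub>R\<^esub> a \<otimes>\<^bsub>R\<^esub> b = k" by blast
qed

section \<open>The quotient by a graded ideal and its regularity\<close>

lemma graded_ring_quotient:
  assumes J: "ideal J R" and gr: "graded_left_ideal G R A J"
  shows "graded_ring G (R Quot J) (quotient_grading R J A)"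
proof -
  let ?Q = "R Quot J" and ?q = "(+>\<^bsub>R\<^esub>) J"
  interpret J: ideal J R by fact
  have zeroQ: "\<zero>\<^bsub>?Q\<^esub> = J" and carrierQ: "carrier ?Q = ?q ` carrier R"
    by (auto simp: FactRing_simps)
  interpret q: ring_hom_ring R ?Q ?q by (rule J.rcos_ring_hom_ring)
  have ker: "?q x = \<zero>\<^bsub>?Q\<^esub> \<longleftrightarrow> x \<in> J" if "x \<in> carrier R" for x
    using J.a_rcos_self[OF that] J.a_rcos_const[of x] zeroQ by metis
  have sumQ: "finsum R z F \<in> carrier R \<and> ?q (finsum R z F) = finsum ?Q (\<lambda>i. ?q (z i)) F"
    if "z \<in> F \<rightarrow> carrier R" for z and F :: "'g set"
    by (rule finsum_additive_image[OF R.abelian_group_axioms q.S.abelian_group_axioms])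
      (use that in \<open>auto intro: additive_subgroupI R.add.subgroup_self\<close>)
  have "internal_direct_sum ?Q (carrier G) (quotient_grading R J A)"
  proof (rule q.S.internal_direct_sumI)
    fix g assume "g \<in> carrier G"
    then show "additive_subgroup (quotient_grading R J A g) ?Q"
      unfolding quotient_grading_def
      by (intro additive_subgroupI q.img_is_add_subgroup homog_subgroup[THEN additive_subgroup.a_subgroup])
  next
    fix X assume "X \<in> carrier ?Q"
    then obtain x where x: "x \<in> carrier R" "X = ?q x"
      unfolding carrierQ by blast
    have S: "finite (hsupp x)" "hsupp x \<subseteq> carrier G" using finite_hsupp[OF x(1)] hsupp_subset by auto
    have "X = finsum ?Q (\<lambda>g. ?q (hcomp g x)) (hsupp x)"
      using sumQ[of "\<lambda>g. hcomp g x" "hsupp x"] x S finsum_hcomp[OF x(1) S(1) order_refl S(2)]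
      by (auto simp: Pi_def subset_iff)
    moreover have "(\<lambda>g. ?q (hcomp g x)) \<in> Pi (hsupp x) (quotient_grading R J A)"
      using hcomp_homog[OF x(1)] S(2) unfolding quotient_grading_def by blast
    ultimately show "\<exists>F z. finite F \<and> F \<subseteq> carrier G \<and> z \<in> Pi F (quotient_grading R J A) \<and> X = finsum ?Q z F"
      using S by blast
  next
    fix F z i assume F: "finite F" "F \<subseteq> carrier G" and z: "z \<in> Pi F (quotient_grading R J A)"
      and 0: "finsum ?Q z F = \<zero>\<^bsub>?Q\<^esub>" and i: "i \<in> F"
    have "\<forall>h\<in>F. \<exists>u. u \<in> A h \<and> z h = ?q u" using z unfolding quotient_grading_def by blast
    then obtain w where w: "\<And>h. h \<in> F \<Longrightarrow> w h \<in> A h \<and> z h = ?q (w h)" by metis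
    then have wA: "w \<in> Pi F A" by blast
    note wR = homog_family_closed[OF F(2) wA]
    have "finsum ?Q z F = finsum ?Q (\<lambda>h. ?q (w h)) F"
      by (rule q.S.add.finprod_cong') (use w wR carrierQ in auto)
    then have "?q (finsum R w F) = \<zero>\<^bsub>?Q\<^esub>" using 0 sumQ[OF wR] by simp
    then have "finsum R w F \<in> J" using sumQ[OF wR] ker by blast
    \<comment> \<open>Independence of the quotient components holds because \<open>J\<close> is
      graded: a lifted sum lying in \<open>J\<close> has every homogeneous component in
      \<open>J\<close>.\<close>
    then have "w i \<in> J"
      using graded_left_idealD(2)[OF gr, of "finsum R w F" i] hcomp_finsum[OF F wA, of i] i F(2) by auto
    then show "z i = \<zero>\<^bsub>?Q\<^esub>" using w[OF i] ker wR i by auto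
  qed
  moreover have "X \<otimes>\<^bsub>?Q\<^esub> Y \<in> quotient_grading R J A (g \<otimes>\<^bsub>G\<^esub> h)"
    if gXY: "g \<in> carrier G" "h \<in> carrier G" "X \<in> quotient_grading R J A g" "Y \<in> quotient_grading R J A h"
    for g h X Y
  proof -
    obtain x y where xy: "x \<in> A g" "X = ?q x" "y \<in> A h" "Y = ?q y"
      using gXY(3,4) unfolding quotient_grading_def by blast
    then have "X \<otimes>\<^bsub>?Q\<^esub> Y = ?q (x \<otimes>\<^bsub>R\<^esub> y)" using q.hom_mult gXY(1,2) by simp
    then show ?thesis
      using graded_mult[OF gXY(1,2) xy(1,3)] unfolding quotient_grading_def by blast
  qed
  ultimately show ?thesis
    by (intro graded_ring.intro G.group_axioms q.S.ring_axioms graded_ring_axioms.intro)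
qed

end

lemma (in gr_self_injective) gr_von_neumann_regular_quotient_jac:
  "gr_von_neumann_regular G (R Quot jac) (quotient_grading R jac A)"
proof (intro gr_von_neumann_regular.intro gr_von_neumann_regular_axioms.intro)
  let ?q = "(+>\<^bsub>R\<^esub>) jac"
  show "graded_ring G (R Quot jac) (quotient_grading R jac A)"
    by (rule graded_ring_quotient[OF ideal_jac graded_left_ideal_jac])
  interpret J: ideal jac R by (rule ideal_jac)
  interpret q: ring_hom_ring R "R Quot jac" ?q by (rule J.rcos_ring_hom_ring)
  fix g X assume g: "g \<in> carrier G" and "X \<in> quotient_grading R jac A g"
  then obtain a where a: "a \<in> A g" "X = ?q a" unfolding quotient_grading_def by blast
  obtain b where b: "b \<in> A (inv\<^bsub>G\<^esub> g)" "a \<ominus>\<^bsub>R\<^esub> a \<otimes>\<^bsub>R\<^esub> b \<otimes>\<^bsub>R\<^esub> a \<in> gr_singular_component R A g"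
    using regular_mod_singular[OF a(1) g] .
  have R: "a \<in> carrier R" "b \<in> carrier R" using a b g by simp_all
  have "?q a = ?q (a \<otimes>\<^bsub>R\<^esub> b \<otimes>\<^bsub>R\<^esub> a)"
    using singular_component_subset_jac[OF b(2) g] R.quotient_eq_iff_same_a_r_cos[OF ideal_jac] R
    by simp
  also have "\<dots> = ?q a \<otimes>\<^bsub>R Quot jac\<^esub> ?q b \<otimes>\<^bsub>R Quot jac\<^esub> ?q a" using R by simp
  finally show "\<exists>B\<in>carrier (R Quot jac). X = X \<otimes>\<^bsub>R Quot jac\<^esub> B \<otimes>\<^bsub>R Quot jac\<^esub> X"
    using a(2) R(2) q.hom_closed by blast
qed

theorem proposition3p4:
  fixes G :: "('g, 't) monoid_scheme"
    and R :: "('r, 's) ring_scheme"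
    and A :: "'g \<Rightarrow> 'r set"
  assumes "graded_ring G R A"
    and "carrier R \<lesssim> (UNIV :: 'm set)"
    and "gr_left_injective TYPE('m) G R A"
  shows "gr_left_singular_ideal G R A = gr_jacobson_radical G R A \<and>
    gr_von_neumann_regular G (R Quot (gr_jacobson_radical G R A))
      (quotient_grading R (gr_jacobson_radical G R A) A)"
proof -
  \<comment> \<open>The cardinality bound acts here: it provides the injection that carries copies
    of the ring and its left ideals into the type of the test modules.\<close>
  interpret gr_self_injective G R A
    using assms by (rule graded_ring.gr_self_injectiveI)
  show ?thesis
    using gr_left_singular_ideal_eq_jac gr_von_neumann_regular_quotient_jac by blast
qed

end
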